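(* Let $\nu\in\mathcal V_x$ and let $\{Q_i\}$, $\nu_i=\nu_{Q_i}$, $\Psi_i(\nu)$ be as produced by the construction described in the context. Suppose that the construction does not stop, so that the $Q_i$ are indexed by $i\in\mathbb N=\{1,2,\dots\}$, and that there exists $i\in\mathbb N$ such that $\Psi_i(\nu)$ is infinite. Regard $\nu^{-1}(\infty)$ as an ideal of $K[y]$. (1) If $\nu^{-1}(\infty)=\{0\}$, then the set $\{Q_i\}_{i\in\mathbb N}$ is complete for $\nu$. (2) If $\nu^{-1}(\infty)\ne\{0\}$, then there exists a key polynomial $Q_\omega$ for $\nu$ that generates the ideal $\nu^{-1}(\infty)$ and is of minimal degree among the polynomials $f\in K[y]$ such that $\nu_i(f)<\nu(f)$ for all $i\in\mathbb N$. Moreover, the set $\{Q_i\}_{i\in\mathbb N}\cup\{Q_\omega\}$ (with $\omega$ larger than all $i\in\mathbb N$) is complete for $\nu$.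
   Context: Let $k$ be a field, $K=k(x)$, and let $y$ be an independent variable. $\mathcal V_x$ denotes the set of valuations of $k(x,y)$ that are normalized, proper, centered at $k[x,y]_{(x,y)}$ and satisfy $\nu(x)=1$; concretely, the set of maps $\nu:K[y]\to\mathbb R\cup\{\infty\}$ with $\nu(f+g)\ge\min(\nu(f),\nu(g))$, $\nu(fg)=\nu(f)+\nu(g)$, $\nu(0)=\infty$, whose restriction to $K$ is the $x$-adic valuation (trivial on $k$, $\nu(x)=1$) and such that $\nu(y)\ge1$. Nonzero polynomials may have value $\infty$. Order: $\mu\le\nu$ iff $\mu(f)\le\nu(f)$ for all $f\in K[y]$. The augmented value group $\Gamma_\nu\subset\mathbb R\cup\{\infty\}$ is the set of values of $\nu$ (including $\infty$), $\nu$ being extended to fractions with denominators of finite value. Truncation: for a monic $Q\in K[y]$ and $g\in K[y]$ write the $Q$-expansion $g=\sum_{j=0}^s g_jQ^j$ with $\deg_y g_j<\deg_y Q$, and put $\nu_Q(g)=\min_j\nu(g_jQ^j)$. Key polynomials: $\partial_b=\frac{1}{b!}\frac{\partial^b}{\partial y^b}$ ($b\ge1$) is the $b$-th formal (Hasse) derivative with respect to $y$; for nonzero $P\in K[y]$ put $\epsilon_\nu(P)=\max_{b\ge1}\frac{\nu(P)-\nu(\partial_bP)}{b}$ (terms with $\nu(\partial_bP)=\infty$ are counted as $-\infty$). A monic $Q\in K[y]$ with $\nu(Q)\ge\nu(y)$ is a key polynomial for $\nu$ if every polynomial $f$ with $\epsilon_\nu(f)\ge\epsilon_\nu(Q)$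 satisfies $\deg_y f\ge\deg_y Q$. Complete set: a set $\{Q_i\}_{i\in I}$ of key polynomials for $\nu$, indexed by a well ordered set $I$, is complete for $\nu$ if for each $\beta\in\Gamma_\nu$ the additive group $\{f\in K[y]\mid\nu(f)\ge\beta\}$ is generated by products $a\prod_{j=1}^sQ_{i_j}^{\gamma_j}$ with $a\in K$, $\gamma_j\in\mathbb Z_{\ge0}$ and $\nu(a)+\sum_{j=1}^s\gamma_j\nu(Q_{i_j})\ge\beta$. Construction: $Q_1=y$, $d_1(\nu)=1$, $\beta_1(\nu)=\nu(y)$, $\nu_1=\nu_{Q_1}$. Suppose $Q_n$ and $\nu_n=\nu_{Q_n}$ are constructed. If $\nu_n=\nu$, stop. Otherwise $\nu_n<\nu$; let $d_{n+1}(\nu)$ be the minimal degree of a monic $f\in K[y]$ with $\nu_n(f)<\nu(f)$, let $\Phi_n(\nu)$ be the set of monic $Q\in K[y]$ with $\deg_yQ=d_{n+1}(\nu)$ and $\nu_n(Q)<\nu(Q)$, let $\Psi_n(\nu)=\nu(\Phi_n(\nu))$ (a set that has a smallest element), let $\beta_{n+1}(\nu)=\min\Psi_n(\nu)$, choose $Q_{n+1}\in\Phi_n(\nu)$ with $\nu(Q_{n+1})=\beta_{n+1}(\nu)$ and put $\nu_{n+1}=\nu_{Q_{n+1}}$ (a valuation with $\nu_n<\nu_{n+1}\le\nu$). *)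

theory Defs
  imports
    "HOL-Computational_Algebra.Computational_Algebra"
    "HOL-Library.Extended_Nat"
    "HOL-Library.Extended_Real"
begin

text \<open>
  For a field \<open>'k\<close>, the field \<open>K = k(x)\<close> is \<open>'k poly fract\<close> and \<open>K[y]\<close> is \<open>'k poly fract poly\<close>.
  Elements of \<open>\<real> \<union> {\<infinity>}\<close> are represented by extended reals different from \<open>-\<infinity>\<close>.
\<close>

type_synonym 'k Ky = "'k poly fract poly"

abbreviation (input) y_var :: "'k::field Ky"
  where "y_var \<equiv> [:0, 1:]"

text \<open>
  The fifth condition says that \<open>\<nu>\<close> restricts to the \<open>x\<close>-adic valuation of \<open>k(x)\<close>; here
  \<open>order 0 a\<close> is the exponent of \<open>x\<close> in \<open>a \<in> k[x]\<close>.
\<close>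

definition Vx :: "('k::field Ky \<Rightarrow> ereal) set"
  where "Vx = {\<nu>.
    (\<forall>f. \<nu> f \<noteq> -\<infinity>) \<and>
    (\<forall>f g. \<nu> (f + g) \<ge> min (\<nu> f) (\<nu> g)) \<and>
    (\<forall>f g. \<nu> (f * g) = \<nu> f + \<nu> g) \<and>
    \<nu> 0 = \<infinity> \<and>
    (\<forall>a b. a \<noteq> 0 \<longrightarrow> b \<noteq> 0 \<longrightarrow>
       \<nu> [:Fract a b:] = ereal (real (order 0 a) - real (order 0 b))) \<and>
    \<nu> y_var \<ge> 1}"

definition value_group :: "('k::field Ky \<Rightarrow> ereal) \<Rightarrow> ereal set"
  where "value_group \<nu> = {\<nu> f - \<nu> g | f g. \<nu> g \<noteq> \<infinity>}"

definition is_expansion :: "'a::field poly \<Rightarrow> 'a poly \<Rightarrow> (nat \<Rightarrow> 'a poly) \<Rightarrow> bool"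
  where "is_expansion Q g c \<longleftrightarrow>
    (\<forall>j. degree (c j) < degree Q) \<and>
    (\<exists>s. (\<forall>j>s. c j = 0) \<and> g = (\<Sum>j\<le>s. c j * Q ^ j))"

lemma is_expansion_step:
  assumes "is_expansion Q g c"
  shows "c 0 = g mod Q" "is_expansion Q (g div Q) (\<lambda>j. c (Suc j))"
proof -
  from assms obtain s where d: "\<And>j. degree (c j) < degree Q"
    and s: "\<And>j. j > s \<Longrightarrow> c j = 0" and g: "g = (\<Sum>j\<le>s. c j * Q ^ j)"
    by (auto simp: is_expansion_def)
  define h where "h = (\<Sum>j\<le>s. c (Suc j) * Q ^ j)"
  have "g = (\<Sum>j\<le>Suc s. c j * Q ^ j)"
    using g s[of "Suc s"] by simp
  also have "\<dots> = c 0 + Q * h"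
    by (subst sum.atMost_Suc_shift) (simp add: h_def sum_distrib_left mult_ac)
  finally have gh: "g = c 0 + Q * h" .
  have "Q \<noteq> 0"
    using d[of 0] by auto
  then have gm: "g mod Q = c 0" and "g div Q = h"
    using d[of 0] by (simp_all add: gh mod_poly_less div_poly_less)
  show "c 0 = g mod Q"
    using gm by simp
  show "is_expansion Q (g div Q) (\<lambda>j. c (Suc j))"
    unfolding is_expansion_def \<open>g div Q = h\<close> h_def
    using d s by (auto intro!: exI[of _ s])
qed

lemma ex1_expansion:
  assumes Q: "degree Q > 0"
  shows "\<exists>!c. is_expansion Q g c"
proof (rule ex_ex1I)
  have mod_less: "degree (g mod Q) < degree Q" for g
    using Q degree_mod_less[of Q g] by fastforce
  show "\<exists>c. is_expansion Q g c"
  proof (induction "degree g" arbitrary: g rule: less_induct)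
    case less
    show ?case
    proof (cases "degree g < degree Q")
      case True
      then have "is_expansion Q g (\<lambda>j. if j = 0 then g else 0)"
        using Q by (auto simp: is_expansion_def intro!: exI[of _ 0])
      then show ?thesis by blast
    next
      case False
      have "degree (g div Q) < degree g"
      proof (cases "g div Q = 0")
        case True
        then show ?thesis
          using False Q by simp
      next
        case nz: False
        have "degree (g div Q * Q) = degree (g div Q) + degree Q"
          using nz Q by (intro degree_mult_eq) auto
        then have "degree (g div Q * Q + g mod Q) = degree (g div Q) + degree Q"
          using mod_less[of g] by (subst degree_add_eq_left) auto
        then show ?thesis
          using Q by simp
      qed
      from less[OF this] obtain c where "is_expansion Q (g div Q) c"
        by blast
      then obtain s where d: "\<And>j. degree (c j) < degree Q"
        and s: "\<And>j. j > s \<Longrightarrow> c j = 0" and h: "g div Q = (\<Sum>j\<le>s. c j * Q ^ j)"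
        unfolding is_expansion_def by blast
      define c' where "c' = (\<lambda>j. case j of 0 \<Rightarrow> g mod Q | Suc i \<Rightarrow> c i)"
      have "g = g mod Q + Q * (g div Q)"
        by simp
      also have "\<dots> = (\<Sum>j\<le>Suc s. c' j * Q ^ j)"
        unfolding h
        by (subst sum.atMost_Suc_shift) (simp add: c'_def sum_distrib_left mult_ac)
      finally have "g = (\<Sum>j\<le>Suc s. c' j * Q ^ j)" .
      moreover have "degree (c' j) < degree Q" for j
        using d mod_less by (auto simp: c'_def split: nat.split)
      moreover have "c' j = 0" if "j > Suc s" for j
        using that s by (auto simp: c'_def split: nat.split)
      ultimately show ?thesis
        unfolding is_expansion_def by blast
    qed
  qed
next
  fix c c'
  assume "is_expansion Q g c" "is_expansion Q g c'"
  then have "c j = c' j" for j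
  proof (induction j arbitrary: g c c')
    case 0
    then show ?case
      using is_expansion_step(1) by metis
  next
    case (Suc j)
    show ?case
      using Suc.IH[OF is_expansion_step(2)[OF Suc.prems(1)]
          is_expansion_step(2)[OF Suc.prems(2)]] .
  qed
  then show "c = c'" by blast
qed

definition expansion :: "'a::field poly \<Rightarrow> 'a poly \<Rightarrow> nat \<Rightarrow> 'a poly"
  where "expansion Q g = (THE c. is_expansion Q g c)"

text \<open>
  The truncation \<open>\<nu>\<^sub>Q\<close>, meaningful for monic \<open>Q\<close> of positive degree.  The infimum is a minimum:
  almost all coefficients of the expansion vanish and contribute \<open>\<infinity>\<close>.
\<close>

definition truncation :: "('k::field Ky \<Rightarrow> ereal) \<Rightarrow> 'k Ky \<Rightarrow> 'k Ky \<Rightarrow> ereal"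
  where "truncation \<nu> Q g = (INF j. \<nu> (expansion Q g j * Q ^ j))"

definition hasse_deriv :: "nat \<Rightarrow> 'a::comm_semiring_1 poly \<Rightarrow> 'a poly"
  where "hasse_deriv b P = (\<Sum>n\<le>degree P. monom (of_nat (n choose b) * coeff P n) (n - b))"

text \<open>
  The supremum is a maximum: \<open>hasse_deriv b P = 0\<close> for \<open>b > degree P\<close>, so almost all terms
  are \<open>-\<infinity>\<close>.
\<close>

definition epsilon :: "('k::field Ky \<Rightarrow> ereal) \<Rightarrow> 'k Ky \<Rightarrow> ereal"
  where "epsilon \<nu> P = (SUP b\<in>{1..}.
    if \<nu> (hasse_deriv b P) = \<infinity> then -\<infinity>
    else (\<nu> P - \<nu> (hasse_deriv b P)) / ereal (real b))"

definition key_polynomial :: "('k::field Ky \<Rightarrow> ereal) \<Rightarrow> 'k Ky \<Rightarrow> bool"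
  where "key_polynomial \<nu> Q \<longleftrightarrow>
    lead_coeff Q = 1 \<and> \<nu> Q \<ge> \<nu> y_var \<and>
    (\<forall>f. f \<noteq> 0 \<longrightarrow> epsilon \<nu> f \<ge> epsilon \<nu> Q \<longrightarrow> degree f \<ge> degree Q)"

text \<open>
  Index sets are subsets of a well-ordered type.  If \<open>\<gamma> i = 0\<close> and \<open>\<nu> (Q i) = \<infinity>\<close>, the
  corresponding summand is \<open>0 * \<infinity> = 0\<close>.
\<close>

definition complete_for ::
    "('k::field Ky \<Rightarrow> ereal) \<Rightarrow> 'i::wellorder set \<Rightarrow> ('i \<Rightarrow> 'k Ky) \<Rightarrow> bool"
  where "complete_for \<nu> I Q \<longleftrightarrow>
    (\<forall>i\<in>I. key_polynomial \<nu> (Q i)) \<and>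
    (\<forall>\<beta>\<in>value_group \<nu>.
       {f. \<nu> f \<ge> \<beta>} =
       group_closure {[:a:] * (\<Prod>i\<in>S. Q i ^ \<gamma> i) | a S \<gamma>.
         finite S \<and> S \<subseteq> I \<and> \<nu> [:a:] + (\<Sum>i\<in>S. ereal (real (\<gamma> i)) * \<nu> (Q i)) \<ge> \<beta>})"

text \<open>
  One step of the construction.  With \<open>Q = Q\<^sub>n\<close>, the following are \<open>d\<^sub>n\<^sub>+\<^sub>1(\<nu>)\<close>, \<open>\<Phi>\<^sub>n(\<nu>)\<close>,
  \<open>\<Psi>\<^sub>n(\<nu>)\<close> and \<open>\<beta>\<^sub>n\<^sub>+\<^sub>1(\<nu>)\<close>.
\<close>

definition next_degree :: "('k::field Ky \<Rightarrow> ereal) \<Rightarrow> 'k Ky \<Rightarrow> nat"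
  where "next_degree \<nu> Q =
    (LEAST d. \<exists>f. lead_coeff f = 1 \<and> degree f = d \<and> truncation \<nu> Q f < \<nu> f)"

definition Phi :: "('k::field Ky \<Rightarrow> ereal) \<Rightarrow> 'k Ky \<Rightarrow> 'k Ky set"
  where "Phi \<nu> Q =
    {P. lead_coeff P = 1 \<and> degree P = next_degree \<nu> Q \<and> truncation \<nu> Q P < \<nu> P}"

definition Psi :: "('k::field Ky \<Rightarrow> ereal) \<Rightarrow> 'k Ky \<Rightarrow> ereal set"
  where "Psi \<nu> Q = \<nu> ` Phi \<nu> Q"

definition next_beta :: "('k::field Ky \<Rightarrow> ereal) \<Rightarrow> 'k Ky \<Rightarrow> ereal"
  where "next_beta \<nu> Q = Inf (Psi \<nu> Q)"

text \<open>
  A run of the construction that never stops, indexed by \<open>n \<ge> 1\<close> (the value \<open>Q 0\<close> is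
  irrelevant).  Since \<open>\<nu> (Q (Suc n)) \<in> Psi \<nu> (Q n)\<close>, the last condition makes the infimum
  a minimum.
\<close>

definition infinite_run :: "('k::field Ky \<Rightarrow> ereal) \<Rightarrow> (nat \<Rightarrow> 'k Ky) \<Rightarrow> bool"
  where "infinite_run \<nu> Q \<longleftrightarrow>
    Q 1 = y_var \<and>
    (\<forall>n\<ge>1. truncation \<nu> (Q n) \<noteq> \<nu> \<and>
       Q (Suc n) \<in> Phi \<nu> (Q n) \<and> \<nu> (Q (Suc n)) = next_beta \<nu> (Q n))"

text \<open>The sequence \<open>Q\<^sub>1, Q\<^sub>2, \<dots>\<close> followed by a further element at the index \<open>\<omega> = \<infinity>\<close>.\<close>

definition append_omega :: "(nat \<Rightarrow> 'a) \<Rightarrow> 'a \<Rightarrow> enat \<Rightarrow> 'a"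
  where "append_omega Q Q\<omega> i = (case i of enat n \<Rightarrow> Q n | \<infinity> \<Rightarrow> Q\<omega>)"

end

theory Submission
  imports Defs
begin

text \<open>
  Let \<open>e = \<epsilon>(Q)\<close> for a key polynomial \<open>Q\<close> with \<open>\<nu>(Q) < \<infinity>\<close>.  If \<open>\<nu>\<^sub>Q(f) < \<nu>(f)\<close>, then some
  Hasse derivative of order \<open>b \<ge> 1\<close> satisfies \<open>\<nu>(\<partial>\<^sub>b f) = \<nu>\<^sub>Q(f) - b e\<close>, whereas \<open>\<epsilon>(f) \<le> e\<close> if
  \<open>\<nu>\<^sub>Q(f) = \<nu>(f)\<close>.  Hence every polynomial in \<open>\<Phi>\<close> is again a key polynomial.

  When some \<open>\<Psi>\<^sub>i\<close> is infinite, the degree of \<open>Q\<^sub>n\<close> is constant for \<open>n > i\<close> and the increasing sequence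
  \<open>\<nu>(Q\<^sub>n)\<close> takes values in finitely many translates of \<open>\<int>\<close>, so it tends to \<open>\<infinity>\<close>, and so does \<open>\<epsilon>(Q\<^sub>n)\<close>.
  If \<open>\<nu>\<^sub>n(f) < \<nu>(f)\<close> for all \<open>n\<close>, the formula above bounds \<open>\<nu>\<^sub>n(f)\<close> from below by
  \<open>\<epsilon>(Q\<^sub>n)\<close> up to a constant, so \<open>\<nu>(f) = \<infinity>\<close>.  Every \<open>f\<close> of finite value therefore satisfies
  \<open>\<nu>\<^sub>n(f) = \<nu>(f)\<close> for some \<open>n\<close>, and iterated \<open>Q\<^sub>n\<close>-, \<dots>, \<open>Q\<^sub>1\<close>-expansions write it in the generators.
\<close>

subsection \<open>Hasse derivatives\<close>

lemma coeff_hasse_deriv: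
  "coeff (hasse_deriv b P) n = of_nat (n + b choose b) * coeff P (n + b)"
proof -
  have "coeff (hasse_deriv b P) n =
      (\<Sum>m\<le>degree P. if m - b = n then of_nat (m choose b) * coeff P m else 0)"
    by (simp add: hasse_deriv_def coeff_sum)
  also have "\<dots> = (\<Sum>m\<le>degree P. if m = n + b then of_nat (m choose b) * coeff P m else 0)"
    by (intro sum.cong refl) (auto simp: binomial_eq_0)
  also have "\<dots> = of_nat (n + b choose b) * coeff P (n + b)"
    by (auto simp: sum.delta coeff_eq_0)
  finally show ?thesis .
qed

lemma hasse_deriv_add: "hasse_deriv b (P + R) = hasse_deriv b P + hasse_deriv b R"
  by (simp add: poly_eq_iff coeff_hasse_deriv algebra_simps)

lemma hasse_deriv_smult: "hasse_deriv b (smult a P) = smult a (hasse_deriv b P)"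
  by (simp add: poly_eq_iff coeff_hasse_deriv algebra_simps)

lemma hasse_deriv_0 [simp]: "hasse_deriv b 0 = 0"
  by (simp add: poly_eq_iff coeff_hasse_deriv)

lemma hasse_deriv_zero [simp]: "hasse_deriv 0 P = P"
  by (simp add: poly_eq_iff coeff_hasse_deriv)

lemma hasse_deriv_sum: "hasse_deriv b (\<Sum>i\<in>A. f i) = (\<Sum>i\<in>A. hasse_deriv b (f i))"
  by (induction A rule: infinite_finite_induct) (simp_all add: hasse_deriv_add)

lemma hasse_deriv_eq_0: "degree P < b \<Longrightarrow> hasse_deriv b P = 0"
  by (simp add: poly_eq_iff coeff_hasse_deriv coeff_eq_0)

text \<open>In every characteristic the top derivative of a nonzero polynomial is a nonzero
  constant, hence of finite value; this keeps \<open>epsilon\<close> of a nonconstant polynomial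
  away from -\<infinity>.\<close>

lemma hasse_deriv_degree: "hasse_deriv (degree P) P = [:lead_coeff P:]"
proof (rule poly_eqI)
  show "coeff (hasse_deriv (degree P) P) n = coeff [:lead_coeff P:] n" for n
    by (cases n) (simp_all add: coeff_hasse_deriv coeff_eq_0)
qed

text \<open>Pascal's rule on coefficients. As \<open>pCons 0\<close> is multiplication by y, this is
  the case of the Leibniz rule that drives the induction in \<open>hasse_deriv_mult\<close>.\<close>

lemma hasse_deriv_pCons_0:
  "hasse_deriv (Suc b) (pCons 0 P) = pCons 0 (hasse_deriv (Suc b) P) + hasse_deriv b P"
proof (rule poly_eqI)
  show "coeff (hasse_deriv (Suc b) (pCons 0 P)) n =
    coeff (pCons 0 (hasse_deriv (Suc b) P) + hasse_deriv b P) n" for n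
    by (cases n) (simp_all add: coeff_hasse_deriv algebra_simps)
qed

lemma hasse_deriv_mult:
  "hasse_deriv b (P * R) = (\<Sum>i\<le>b. hasse_deriv i P * hasse_deriv (b - i) R)"
proof (induction P arbitrary: b)
  case 0
  then show ?case by simp
next
  case (pCons a P)
  have const: "hasse_deriv (Suc i) [:a:] = 0" for i
    by (intro hasse_deriv_eq_0) simp
  have pCons_sum: "pCons 0 (\<Sum>i\<le>n. f i) = (\<Sum>i\<le>n. pCons 0 (f i))" for n and f :: "nat \<Rightarrow> 'a poly"
    by (induction n) (simp_all, metis add_0 add_pCons)
  have split: "pCons a P = [:a:] + pCons 0 P"
    by simp
  show ?case
  proof (cases b)
    case 0
    then show ?thesis by simp
  next
    case (Suc c)
    have "hasse_deriv b (pCons a P * R) =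
        smult a (hasse_deriv b R) + hasse_deriv (Suc c) (pCons 0 (P * R))"
      by (simp add: hasse_deriv_add hasse_deriv_smult Suc)
    also have "hasse_deriv (Suc c) (pCons 0 (P * R)) =
        pCons 0 (\<Sum>i\<le>b. hasse_deriv i P * hasse_deriv (b - i) R) +
        (\<Sum>i\<le>c. hasse_deriv i P * hasse_deriv (c - i) R)"
      by (simp add: hasse_deriv_pCons_0 pCons.IH Suc del: sum.atMost_Suc)
    also have "pCons 0 (\<Sum>i\<le>b. hasse_deriv i P * hasse_deriv (b - i) R) =
        (\<Sum>i\<le>b. pCons 0 (hasse_deriv i P) * hasse_deriv (b - i) R)"
      by (simp add: pCons_sum)
    finally have "hasse_deriv b (pCons a P * R) = smult a (hasse_deriv b R) +
        ((\<Sum>i\<le>b. pCons 0 (hasse_deriv i P) * hasse_deriv (b - i) R) +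
        (\<Sum>i\<le>c. hasse_deriv i P * hasse_deriv (c - i) R))" .
    also have "\<dots> = (\<Sum>i\<le>b. hasse_deriv i (pCons a P) * hasse_deriv (b - i) R)"
      unfolding Suc
      \<comment> \<open>Only the term of index 0 involves \<open>a\<close>; in each later term
        \<open>hasse_deriv_pCons_0\<close> yields one summand for each of the two sums.\<close>
      by (subst (1 2) sum.atMost_Suc_shift)
         (subst split, simp only: hasse_deriv_add hasse_deriv_pCons_0 const,
          simp add: sum.distrib algebra_simps)
    finally show ?thesis .
  qed
qed

subsection \<open>Expansions\<close>

lemma degree_diff_monic_less:
  fixes P R :: "'a::comm_ring_1 poly"
  assumes "degree P = degree R" "lead_coeff P = 1" "lead_coeff R = 1" "degree R > 0"
  shows "degree (P - R) < degree R"
proof (cases "P = R")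
  case False
  have "degree (P - R) \<le> degree R"
    using assms(1) degree_diff_le_max[of P R] by simp
  moreover have "coeff (P - R) (degree R) = 0"
    using assms by simp
  ultimately show ?thesis
    using False by (metis eq_iff_diff_eq_0 leading_coeff_0_iff le_neq_implies_less)
qed (use assms in simp)

lemma is_expansion_expansion:
  "degree Q > 0 \<Longrightarrow> is_expansion Q g (expansion Q g)"
  unfolding expansion_def by (rule theI'[OF ex1_expansion])

lemma is_expansion_degree: "is_expansion Q g c \<Longrightarrow> degree (c j) < degree Q"
  by (simp add: is_expansion_def)

lemma is_expansion_degree_pos: "is_expansion Q g c \<Longrightarrow> degree Q > 0"
  using is_expansion_degree by fastforce

lemma expansion_eq: "is_expansion Q g c \<Longrightarrow> expansion Q g = c"
  using ex1_expansion[OF is_expansion_degree_pos] is_expansion_expansion[OF is_expansion_degree_pos]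
  by metis

lemma is_expansion_sum:
  assumes "is_expansion Q g c"
  obtains s where "\<And>j. j > s \<Longrightarrow> c j = 0" "g = (\<Sum>j\<le>s. c j * Q ^ j)"
  using assms by (auto simp: is_expansion_def)

lemma is_expansion_sumI:
  assumes "\<And>j. degree (c j) < degree Q" "\<And>j. j > s \<Longrightarrow> c j = 0"
  shows "is_expansion Q (\<Sum>j\<le>s. c j * Q ^ j) c"
  using assms by (auto simp: is_expansion_def)

lemma smult_sum_right: "smult a (\<Sum>i\<in>A. f i) = (\<Sum>i\<in>A. smult a (f i))"
  by (induction A rule: infinite_finite_induct) (simp_all add: smult_add_right)

lemma is_expansion_smult:
  assumes "is_expansion Q g c"
  shows "is_expansion Q (smult a g) (\<lambda>j. smult a (c j))"
proof -
  obtain s where s: "\<And>j. j > s \<Longrightarrow> c j = 0" "g = (\<Sum>j\<le>s. c j * Q ^ j)"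
    using is_expansion_sum[OF assms] by blast
  have "is_expansion Q (\<Sum>j\<le>s. smult a (c j) * Q ^ j) (\<lambda>j. smult a (c j))"
    using is_expansion_degree[OF assms] is_expansion_degree_pos[OF assms] s(1)
    by (intro is_expansion_sumI) (auto intro: le_less_trans[OF degree_smult_le])
  also have "(\<Sum>j\<le>s. smult a (c j) * Q ^ j) = smult a g"
    by (simp add: s(2) smult_sum_right)
  finally show ?thesis .
qed

lemma is_expansion_low_degree:
  assumes "degree g < degree Q"
  shows "is_expansion Q g (\<lambda>j. if j = 0 then g else 0)"
  using assms by (auto simp: is_expansion_def intro!: exI[of _ 0])

lemma is_expansion_affine:
  assumes "degree r < degree Q"
  shows "is_expansion Q (Q + r) (\<lambda>j. if j = 0 then r else if j = 1 then 1 else 0)"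
  using assms by (auto simp: is_expansion_def intro!: exI[of _ 1])

lemma degree_expansion_sum_less:
  fixes Q :: "'a::field poly"
  assumes "\<And>j. degree (c j) < degree Q"
  shows "degree (\<Sum>j\<le>n. c j * Q ^ j) < Suc n * degree Q"
proof (induction n)
  case 0
  then show ?case using assms(1)[of 0] by simp
next
  case (Suc n)
  have "Q \<noteq> 0"
    using assms(1)[of 0] by auto
  then have "degree (c (Suc n) * Q ^ Suc n) \<le> degree (c (Suc n)) + Suc n * degree Q"
    using degree_mult_le[of "c (Suc n)" "Q ^ Suc n"]
    by (simp add: degree_power_eq del: power_Suc)
  also have "\<dots> < Suc (Suc n) * degree Q"
    using assms(1)[of "Suc n"] by simp
  finally show ?case
    using Suc by (simp del: power_Suc) (rule degree_add_less, auto)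
qed

lemma degree_expansion_sum:
  fixes Q :: "'a::field poly"
  assumes "\<And>j. degree (c j) < degree Q" "c s \<noteq> 0"
  shows "degree (\<Sum>j\<le>s. c j * Q ^ j) = degree (c s) + s * degree Q"
proof (cases s)
  case 0
  then show ?thesis by simp
next
  case (Suc t)
  have "Q \<noteq> 0"
    using assms(1)[of 0] by auto
  then have "degree (c s * Q ^ s) = degree (c s) + s * degree Q"
    using assms(2) by (simp add: degree_mult_eq degree_power_eq)
  with degree_expansion_sum_less[of c Q t, OF assms(1)] show ?thesis
    unfolding Suc by (simp del: power_Suc add: degree_add_eq_right)
qed

lemma is_expansion_top:
  fixes Q :: "'a::field poly"
  assumes "is_expansion Q g c" "g \<noteq> 0"
  obtains s where "g = (\<Sum>j\<le>s. c j * Q ^ j)" "c s \<noteq> 0" "\<And>j. j > s \<Longrightarrow> c j = 0"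
    "degree g = degree (c s) + s * degree Q"
proof -
  obtain t where t: "\<And>j. j > t \<Longrightarrow> c j = 0" "g = (\<Sum>j\<le>t. c j * Q ^ j)"
    using is_expansion_sum[OF assms(1)] by blast
  have ex: "\<exists>j. c j \<noteq> 0"
  proof (rule ccontr)
    assume "\<not> ?thesis"
    then have "g = 0"
      by (subst t(2)) simp
    with assms(2) show False by simp
  qed
  define s where "s = Max {j. c j \<noteq> 0}"
  have "j \<le> t" if "c j \<noteq> 0" for j
    using t(1)[of j] that by (cases "j \<le> t") auto
  then have fin: "finite {j. c j \<noteq> 0}"
    by (auto intro: finite_subset[of _ "{..t}"])
  have cs: "c s \<noteq> 0"
    using Max_in[OF fin] ex by (auto simp: s_def)
  have s0: "c j = 0" if "j > s" for j
    using Max_ge[OF fin, of j] that by (force simp: s_def)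
  have "s \<le> t"
    using cs t(1) by (meson not_less)
  then have g: "g = (\<Sum>j\<le>s. c j * Q ^ j)"
    unfolding t(2) using s0 by (intro sum.mono_neutral_right) auto
  then show ?thesis
    using that cs s0 degree_expansion_sum[of c Q s, OF is_expansion_degree[OF assms(1)] cs] by blast
qed

subsection \<open>Valuations and truncations\<close>

text \<open>Clears the denominator in \<open>epsilon\<close>: a quotient is at most e iff the value
  u of the derivative of order b lies on or above the line b \<mapsto> v - b e.\<close>

lemma ereal_quotient_le_iff:
  "1 \<le> b \<Longrightarrow> (ereal v - ereal u) / ereal (real b) \<le> ereal e \<longleftrightarrow> v - real b * e \<le> u"
  by (simp add: field_simps)

lemma ereal_quotient_less_iff:
  "1 \<le> b \<Longrightarrow> (ereal v - ereal u) / ereal (real b) < ereal e \<longleftrightarrow> v - real b * e < u"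
  by (simp add: field_simps)

locale Vx_valuation =
  fixes \<nu> :: "'k::field Ky \<Rightarrow> ereal"
  assumes in_Vx: "\<nu> \<in> Vx"
begin

lemma val_not_MInf [simp]: "\<nu> f \<noteq> -\<infinity>"
  using in_Vx by (simp add: Vx_def)

lemma val_mult: "\<nu> (f * g) = \<nu> f + \<nu> g"
  using in_Vx by (simp add: Vx_def)

lemma val_add: "min (\<nu> f) (\<nu> g) \<le> \<nu> (f + g)"
  using in_Vx by (simp add: Vx_def)

lemma val_0 [simp]: "\<nu> 0 = \<infinity>"
  using in_Vx by (simp add: Vx_def)

lemma val_y: "1 \<le> \<nu> y_var"
  using in_Vx by (simp add: Vx_def)

text \<open>Integrality on constants is the source of the discreteness in
  \<open>truncation_discrete\<close>.\<close>

lemma val_const: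
  assumes "a \<noteq> 0"
  obtains z :: int where "\<nu> [:a:] = ereal (of_int z)"
proof -
  obtain p q where pq: "a = Fract p q" "q \<noteq> 0"
    by (cases a) auto
  with assms have "p \<noteq> 0"
    by (auto simp: rat_number_collapse eq_fract Zero_fract_def)
  with pq in_Vx have "\<nu> [:a:] = ereal (real (order 0 p) - real (order 0 q))"
    by (simp add: Vx_def)
  also have "\<dots> = ereal (of_int (int (order 0 p) - int (order 0 q)))"
    by simp
  finally show ?thesis
    using that by blast
qed

lemma val_const_finite: "a \<noteq> 0 \<Longrightarrow> \<nu> [:a:] \<noteq> \<infinity>"
  by (metis val_const PInfty_neq_ereal(1))

lemma val_1 [simp]: "\<nu> 1 = 0"
proof -
  have "\<nu> 1 = \<nu> 1 + \<nu> 1"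
    using val_mult[of 1 1] by simp
  moreover have "\<nu> 1 \<noteq> \<infinity>"
    using val_const_finite[of 1] by (simp flip: one_pCons)
  ultimately show ?thesis
    by (cases "\<nu> 1") auto
qed

lemma val_minus [simp]: "\<nu> (- f) = \<nu> f"
proof -
  have "\<nu> (-1) + \<nu> (-1) = 0"
    using val_mult[of "-1" "-1"] by simp
  then have "\<nu> (-1) = 0"
    by (cases "\<nu> (-1)") auto
  then show ?thesis
    using val_mult[of "-1" f] by simp
qed

lemma val_diff: "min (\<nu> f) (\<nu> g) \<le> \<nu> (f - g)"
  using val_add[of f "- g"] by simp

lemma val_add_ge: "v \<le> \<nu> f \<Longrightarrow> v \<le> \<nu> g \<Longrightarrow> v \<le> \<nu> (f + g)"
  using val_add[of f g] by (auto simp: min_def split: if_splits)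

lemma val_add_gt: "v < \<nu> f \<Longrightarrow> v < \<nu> g \<Longrightarrow> v < \<nu> (f + g)"
  using val_add[of f g] by (auto simp: min_def split: if_splits)

lemma val_add_eq:
  assumes "\<nu> f < \<nu> g"
  shows "\<nu> (f + g) = \<nu> f"
proof (rule antisym)
  show "\<nu> f \<le> \<nu> (f + g)"
    using assms by (intro val_add_ge) auto
  have "\<not> \<nu> f < \<nu> (f + g)"
    using val_add_gt[of "\<nu> f" "f + g" "- g"] assms by auto
  then show "\<nu> (f + g) \<le> \<nu> f" by simp
qed

lemma val_sum_ge: "(\<And>i. i \<in> A \<Longrightarrow> v \<le> \<nu> (f i)) \<Longrightarrow> v \<le> \<nu> (\<Sum>i\<in>A. f i)"
  by (induction A rule: infinite_finite_induct) (auto intro: val_add_ge)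

lemma val_sum_gt:
  "v \<noteq> \<infinity> \<Longrightarrow> (\<And>i. i \<in> A \<Longrightarrow> v < \<nu> (f i)) \<Longrightarrow> v < \<nu> (\<Sum>i\<in>A. f i)"
  by (induction A rule: infinite_finite_induct) (auto intro: val_add_gt)

lemma val_sum_eq:
  assumes "finite A" "i \<in> A" "\<nu> (f i) = v" "v \<noteq> \<infinity>" "\<And>j. j \<in> A \<Longrightarrow> j \<noteq> i \<Longrightarrow> v < \<nu> (f j)"
  shows "\<nu> (\<Sum>i\<in>A. f i) = v"
proof -
  have "\<nu> (f i) < \<nu> (\<Sum>j\<in>A - {i}. f j)"
    using assms by (intro val_sum_gt) auto
  then show ?thesis
    using val_add_eq assms by (simp add: sum.remove[of A i])
qed

lemma val_power: "\<nu> (f ^ n) = ereal (real n) * \<nu> f"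
proof (induction n)
  case (Suc n)
  then show ?case
    by (cases "\<nu> f") (simp_all add: val_mult algebra_simps zero_ereal_def)
qed (simp add: zero_ereal_def[symmetric])

lemma val_prod: "\<nu> (\<Prod>i\<in>A. f i) = (\<Sum>i\<in>A. \<nu> (f i))"
  by (induction A rule: infinite_finite_induct) (simp_all add: val_mult)

abbreviation tr where "tr \<equiv> truncation \<nu>"

lemma truncation_expansion: "is_expansion Q g c \<Longrightarrow> tr Q g = (INF j. \<nu> (c j * Q ^ j))"
  by (simp add: truncation_def expansion_eq)

lemma truncation_le: "is_expansion Q g c \<Longrightarrow> tr Q g \<le> \<nu> (c j * Q ^ j)"
  by (auto simp: truncation_expansion intro: INF_lower)

lemma truncation_attained:
  assumes "is_expansion Q g c"
  obtains j where "tr Q g = \<nu> (c j * Q ^ j)"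
proof -
  obtain s where s: "\<And>j. j > s \<Longrightarrow> c j = 0"
    using is_expansion_sum[OF assms] by blast
  have "range (\<lambda>j. \<nu> (c j * Q ^ j)) \<subseteq> insert \<infinity> ((\<lambda>j. \<nu> (c j * Q ^ j)) ` {..s})"
    using s by (force simp: not_less[symmetric])
  then have fin: "finite (range (\<lambda>j. \<nu> (c j * Q ^ j)))"
    by (rule finite_subset) simp
  have "Inf (range (\<lambda>j. \<nu> (c j * Q ^ j))) = Min (range (\<lambda>j. \<nu> (c j * Q ^ j)))"
    by (rule cInf_eq_Min[OF fin]) simp
  moreover have "Min (range (\<lambda>j. \<nu> (c j * Q ^ j))) \<in> range (\<lambda>j. \<nu> (c j * Q ^ j))"
    by (rule Min_in[OF fin]) simp
  ultimately obtain j where "Inf (range (\<lambda>j. \<nu> (c j * Q ^ j))) = \<nu> (c j * Q ^ j)"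
    by (metis (no_types, lifting) rangeE)
  then show ?thesis
    using that truncation_expansion[OF assms] by simp
qed

lemma truncation_le_val:
  assumes "degree Q > 0"
  shows "tr Q g \<le> \<nu> g"
proof -
  obtain c where c: "is_expansion Q g c"
    using is_expansion_expansion[OF assms] by blast
  obtain s where "g = (\<Sum>j\<le>s. c j * Q ^ j)"
    using is_expansion_sum[OF c] by blast
  then show ?thesis
    using truncation_le[OF c] by (auto intro!: val_sum_ge)
qed

lemma truncation_low_degree:
  assumes "degree g < degree Q"
  shows "tr Q g = \<nu> g"
proof (rule antisym)
  have c: "is_expansion Q g (\<lambda>j. if j = 0 then g else 0)"
    by (rule is_expansion_low_degree[OF assms])
  show "tr Q g \<le> \<nu> g"
    using truncation_le[OF c, of 0] by simp
  show "\<nu> g \<le> tr Q g"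
    unfolding truncation_expansion[OF c] by (intro INF_greatest) auto
qed

lemma truncation_smult:
  assumes "degree Q > 0" "a \<noteq> 0"
  shows "tr Q (smult a g) = \<nu> [:a:] + tr Q g"
proof -
  have c: "is_expansion Q g (expansion Q g)"
    by (rule is_expansion_expansion[OF assms(1)])
  obtain z where z: "\<nu> [:a:] = ereal z"
    using val_const[OF assms(2)] by metis
  have v: "\<nu> (smult a f) = ereal z + \<nu> f" for f
    using val_mult[of "[:a:]" f] z by simp
  note c' = is_expansion_smult[OF c, of a]
  have "tr Q (smult a g) = ereal z + tr Q g"
  proof (rule antisym)
    obtain j where "tr Q g = \<nu> (expansion Q g j * Q ^ j)"
      using truncation_attained[OF c] .
    then show "tr Q (smult a g) \<le> ereal z + tr Q g"
      using truncation_le[OF c', of j] by (simp add: v)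
    obtain j where "tr Q (smult a g) = \<nu> (smult a (expansion Q g j) * Q ^ j)"
      using truncation_attained[OF c'] .
    then show "ereal z + tr Q g \<le> tr Q (smult a g)"
      using add_left_mono[OF truncation_le[OF c, of j], of "ereal z"] by (simp add: v)
  qed
  then show ?thesis by (simp add: z)
qed

lemma truncation_affine:
  assumes "degree r < degree Q"
  shows "tr Q (Q + r) = min (\<nu> Q) (\<nu> r)"
proof (rule antisym)
  have c: "is_expansion Q (Q + r) (\<lambda>j. if j = 0 then r else if j = 1 then 1 else 0)"
    by (rule is_expansion_affine[OF assms])
  show "tr Q (Q + r) \<le> min (\<nu> Q) (\<nu> r)"
    using truncation_le[OF c, of 0] truncation_le[OF c, of 1] by simp
  show "min (\<nu> Q) (\<nu> r) \<le> tr Q (Q + r)"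
    unfolding truncation_expansion[OF c] by (intro INF_greatest) auto
qed

text \<open>Every term with a positive power of \<open>Q\<close> has infinite value, so both sides
  equal the value of the constant term. Consequently a run that does not stop contains no
  \<open>Q\<close> of infinite value.\<close>

lemma truncation_infinite:
  assumes "degree Q > 0" "\<nu> Q = \<infinity>"
  shows "tr Q = \<nu>"
proof
  fix g
  obtain c where c: "is_expansion Q g c"
    using is_expansion_expansion[OF assms(1)] by blast
  have inf: "\<nu> (c j * Q ^ j) = \<infinity>" if "j \<noteq> 0" for j
    using assms(2) that by (simp add: val_mult val_power)
  obtain s where s: "g = (\<Sum>j\<le>s. c j * Q ^ j)"
    using is_expansion_sum[OF c] by blast
  have g: "g = c 0 + (\<Sum>j\<in>{..s} - {0}. c j * Q ^ j)"
    by (subst s, subst sum.remove[of _ 0]) auto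
  have sum: "\<nu> (\<Sum>j\<in>{..s} - {0}. c j * Q ^ j) = \<infinity>"
    using val_sum_ge[of "{..s} - {0}" \<infinity> "\<lambda>j. c j * Q ^ j"] inf by auto
  have "\<nu> (c 0) \<le> \<nu> g"
    by (subst g, intro val_add_ge) (auto simp: sum)
  moreover have "\<nu> g \<le> \<nu> (c 0)"
    using val_diff[of g "\<Sum>j\<in>{..s} - {0}. c j * Q ^ j"] sum g by (simp add: min_def)
  moreover have "tr Q g = \<nu> (c 0)"
  proof (rule antisym)
    show "tr Q g \<le> \<nu> (c 0)"
      using truncation_le[OF c, of 0] by simp
    show "\<nu> (c 0) \<le> tr Q g"
      unfolding truncation_expansion[OF c]
    proof (rule INF_greatest)
      show "\<nu> (c 0) \<le> \<nu> (c j * Q ^ j)" for j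
        using inf[of j] by (cases "j = 0") auto
    qed
  qed
  ultimately show "tr Q g = \<nu> g" by simp
qed

text \<open>\<open>next_degree\<close> ranges over monic polynomials only; dividing by the leading
  coefficient shifts \<nu> and the truncation by the same finite amount.\<close>

lemma truncation_below_next_degree:
  assumes "degree Q > 0" "degree f < next_degree \<nu> Q"
  shows "tr Q f = \<nu> f"
proof (cases "f = 0")
  case True
  then show ?thesis using truncation_low_degree[of 0 Q] assms(1) by simp
next
  case False
  define a where "a = lead_coeff f"
  define g where "g = smult (inverse a) f"
  have a: "a \<noteq> 0" "f = smult a g" using False by (auto simp: a_def g_def)
  have g: "lead_coeff g = 1" "degree g = degree f"
    using False by (auto simp: g_def a_def)
  have "\<not> tr Q g < \<nu> g"
    using not_less_Least[OF assms(2)[unfolded next_degree_def]] g by blast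
  then have "tr Q g = \<nu> g"
    using truncation_le_val[OF assms(1), of g] by auto
  then show ?thesis
    unfolding a(2) using truncation_smult[OF assms(1) a(1)] val_mult[of "[:a:]" g] by simp
qed

subsection \<open>Key polynomials and Hasse derivatives\<close>

lemma val_mult_ge: "ereal x \<le> \<nu> f \<Longrightarrow> ereal y \<le> \<nu> g \<Longrightarrow> ereal (x + y) \<le> \<nu> (f * g)"
  using add_mono[of "ereal x" "\<nu> f" "ereal y" "\<nu> g"] by (simp add: val_mult)

lemma val_mult_gt: "ereal x < \<nu> f \<Longrightarrow> ereal y \<le> \<nu> g \<Longrightarrow> ereal (x + y) < \<nu> (f * g)"
  by (cases "\<nu> f"; cases "\<nu> g") (auto simp: val_mult)

lemma val_mult_gt': "ereal x \<le> \<nu> f \<Longrightarrow> ereal y < \<nu> g \<Longrightarrow> ereal (x + y) < \<nu> (f * g)"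
  by (cases "\<nu> f"; cases "\<nu> g") (auto simp: val_mult)

lemma val_finiteE:
  assumes "\<nu> f \<noteq> \<infinity>"
  obtains v where "\<nu> f = ereal v"
  using assms by (cases "\<nu> f") auto

section \<open>Estimates for epsilon\<close>

lemma epsilon_term_le:
  assumes "1 \<le> b" "\<nu> (hasse_deriv b f) \<noteq> \<infinity>"
  shows "(\<nu> f - \<nu> (hasse_deriv b f)) / ereal (real b) \<le> epsilon \<nu> f"
proof -
  have "(if \<nu> (hasse_deriv b f) = \<infinity> then - \<infinity>
      else (\<nu> f - \<nu> (hasse_deriv b f)) / ereal (real b)) \<le> epsilon \<nu> f"
    unfolding epsilon_def using assms(1) by (intro SUP_upper) auto
  with assms(2) show ?thesis by simp
qed

lemma val_hasse_ge:
  assumes "epsilon \<nu> f \<le> ereal e" "\<nu> f = ereal v" "1 \<le> b"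
  shows "ereal (v - real b * e) \<le> \<nu> (hasse_deriv b f)"
proof (cases "\<nu> (hasse_deriv b f) = \<infinity>")
  case False
  then obtain u where u: "\<nu> (hasse_deriv b f) = ereal u"
    by (rule val_finiteE)
  have "(ereal v - ereal u) / ereal (real b) \<le> ereal e"
    using order_trans[OF epsilon_term_le[OF assms(3) False] assms(1)] u assms(2) by simp
  with u show ?thesis
    using ereal_quotient_le_iff[OF assms(3)] by simp
qed simp

lemma val_hasse_gt:
  assumes "epsilon \<nu> f < ereal e" "\<nu> f = ereal v" "1 \<le> b"
  shows "ereal (v - real b * e) < \<nu> (hasse_deriv b f)"
proof (cases "\<nu> (hasse_deriv b f) = \<infinity>")
  case False
  then obtain u where u: "\<nu> (hasse_deriv b f) = ereal u"
    by (rule val_finiteE)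
  have "(ereal v - ereal u) / ereal (real b) < ereal e"
    using le_less_trans[OF epsilon_term_le[OF assms(3) False] assms(1)] u assms(2) by simp
  with u show ?thesis
    using ereal_quotient_less_iff[OF assms(3)] by simp
qed simp

lemma epsilon_leI:
  assumes "\<nu> f = ereal v" "\<And>b. 1 \<le> b \<Longrightarrow> ereal (v - real b * e) \<le> \<nu> (hasse_deriv b f)"
  shows "epsilon \<nu> f \<le> ereal e"
  unfolding epsilon_def
proof (rule SUP_least)
  fix b :: nat
  assume "b \<in> {1..}"
  then have b: "1 \<le> b" by simp
  show "(if \<nu> (hasse_deriv b f) = \<infinity> then - \<infinity>
      else (\<nu> f - \<nu> (hasse_deriv b f)) / ereal (real b)) \<le> ereal e"
  proof (cases "\<nu> (hasse_deriv b f) = \<infinity>")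
    case False
    then obtain u where u: "\<nu> (hasse_deriv b f) = ereal u"
      by (rule val_finiteE)
    with assms(2)[OF b] have "(ereal v - ereal u) / ereal (real b) \<le> ereal e"
      using ereal_quotient_le_iff[OF b] by simp
    with False u assms(1) show ?thesis by simp
  qed simp
qed

text \<open>Nonzero constants have finite value, so f is nonconstant, and its derivative of order
  \<open>degree f\<close> is a nonzero constant. The corresponding quotient is infinite.\<close>

lemma epsilon_infinite:
  assumes "\<nu> f = \<infinity>" "f \<noteq> 0"
  shows "epsilon \<nu> f = \<infinity>"
proof -
  have lc: "\<nu> [:lead_coeff f:] \<noteq> \<infinity>"
    using assms(2) by (intro val_const_finite) simp
  have "degree f \<noteq> 0"
    using lc assms(1) by (metis degree_0_id)
  then have "1 \<le> degree f" by simp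
  from epsilon_term_le[OF this, of f] lc assms(1) show ?thesis
    by (cases "\<nu> [:lead_coeff f:]") (auto simp: hasse_deriv_degree \<open>degree f \<noteq> 0\<close>)
qed

lemma epsilon_finite:
  assumes "\<nu> f \<noteq> \<infinity>"
  shows "epsilon \<nu> f \<noteq> \<infinity>"
proof -
  obtain v where v: "\<nu> f = ereal v"
    using assms by (rule val_finiteE)
  \<comment> \<open>\<open>real_of_ereal\<close> sends infinite values to 0; such entries can only
    enlarge the maximum, and derivatives of infinite value satisfy the bound anyway.\<close>
  define D where "D = (\<lambda>b. v - real_of_ereal (\<nu> (hasse_deriv b f))) ` {..degree f}"
  \<comment> \<open>Nonnegativity of \<open>M\<close> gives M \<le> b M for b \<ge> 1, so one bound
    serves all orders.\<close>
  define M where "M = max 0 (Max D)"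
  have "epsilon \<nu> f \<le> ereal M"
  proof (rule epsilon_leI[OF v])
    fix b :: nat
    assume b: "1 \<le> b"
    show "ereal (v - real b * M) \<le> \<nu> (hasse_deriv b f)"
    proof (cases "\<nu> (hasse_deriv b f) = \<infinity>")
      case False
      then have "b \<le> degree f"
        using hasse_deriv_eq_0[of f b] by (cases "b \<le> degree f") auto
      obtain u where u: "\<nu> (hasse_deriv b f) = ereal u"
        using False by (rule val_finiteE)
      have "v - u \<in> D"
        unfolding D_def using \<open>b \<le> degree f\<close> u by (intro image_eqI[of _ _ b]) auto
      then have "v - u \<le> Max D"
        by (intro Max_ge) (simp_all add: D_def)
      also have "Max D \<le> M"
        by (simp add: M_def)
      also have "M \<le> real b * M"
        using b mult_right_mono[of 1 "real b" M] by (simp add: M_def)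
      finally show ?thesis
        using u by simp
    qed simp
  qed
  then show ?thesis by auto
qed

text \<open>The point of order b lies on a line of slope -e that starts at v. As f itself has value
  above v, the descent from order 0 to order b is steeper than e.\<close>

lemma epsilon_gtI:
  assumes "1 \<le> b" "\<nu> (hasse_deriv b f) = ereal (v - real b * e)" "ereal v < \<nu> f"
  shows "ereal e < epsilon \<nu> f"
proof (cases "\<nu> f = \<infinity>")
  case True
  have "f \<noteq> 0"
    using assms(2) by auto
  with True show ?thesis
    by (simp add: epsilon_infinite)
next
  case False
  then obtain w where w: "\<nu> f = ereal w"
    by (rule val_finiteE)
  show ?thesis
  proof (rule ccontr)
    assume "\<not> ?thesis"
    then have "epsilon \<nu> f \<le> ereal e" by simp
    from val_hasse_ge[OF this w assms(1)] assms w show False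
      by simp
  qed
qed

lemma epsilon_const:
  assumes "degree f = 0"
  shows "epsilon \<nu> f = -\<infinity>"
proof -
  have "hasse_deriv b f = 0" if "1 \<le> b" for b
    using that assms by (intro hasse_deriv_eq_0) simp
  then show ?thesis
    by (simp add: epsilon_def)
qed

text \<open>Orders above the degree contribute -\<infinity>, so the supremum runs over finitely many
  values. The top derivative of a monic polynomial is 1, so the maximum is not -\<infinity>.\<close>

lemma epsilon_attained:
  assumes "lead_coeff P = 1" "degree P > 0" "\<nu> P = ereal q"
  obtains b e where "1 \<le> b" "epsilon \<nu> P = ereal e" "\<nu> (hasse_deriv b P) = ereal (q - real b * e)"
proof -
  define t where "t = (\<lambda>b. if \<nu> (hasse_deriv b P) = \<infinity> then - \<infinity>
      else (\<nu> P - \<nu> (hasse_deriv b P)) / ereal (real b))"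
  have eps: "epsilon \<nu> P = Sup (t ` {1..})"
    by (simp add: epsilon_def t_def)
  have "t ` {1..} \<subseteq> insert (-\<infinity>) (t ` {1..degree P})"
  proof (rule image_subsetI)
    fix b :: nat
    assume "b \<in> {1..}"
    then show "t b \<in> insert (- \<infinity>) (t ` {1..degree P})"
      by (cases "b \<le> degree P") (auto simp: t_def hasse_deriv_eq_0)
  qed
  then have fin: "finite (t ` {1..})"
    by (rule finite_subset) simp
  have "Sup (t ` {1..}) \<in> t ` {1..}"
    using Max_in[OF fin] cSup_eq_Max[OF fin] by auto
  then obtain b where b: "1 \<le> b" "epsilon \<nu> P = t b"
    unfolding eps by auto
  have "\<nu> (hasse_deriv (degree P) P) = 0"
    using assms(1) by (simp add: hasse_deriv_degree flip: one_pCons)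
  then have "ereal q / ereal (real (degree P)) \<le> epsilon \<nu> P"
    using epsilon_term_le[of "degree P" P] assms by simp
  then have "t b \<noteq> -\<infinity>"
    using b assms(2) by auto
  then have "\<nu> (hasse_deriv b P) \<noteq> \<infinity>"
    by (auto simp: t_def)
  then obtain u where u: "\<nu> (hasse_deriv b P) = ereal u"
    by (rule val_finiteE)
  have "epsilon \<nu> P = ereal ((q - u) / real b)"
    using b u assms(3) by (simp add: t_def)
  moreover have "u = q - real b * ((q - u) / real b)"
    using b(1) by simp
  ultimately show ?thesis
    using that b(1) u by metis
qed

text \<open>The line \<open>b \<mapsto> v - b e\<close> supports \<open>b \<mapsto> \<nu> (\<partial>\<^sub>b f)\<close> from below, with last point of contact
  \<open>N\<close>; as for Newton polygons, \<open>v\<close> and \<open>N\<close> are additive in \<open>f\<close>.\<close>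

definition contact :: "real \<Rightarrow> 'k Ky \<Rightarrow> real \<Rightarrow> nat \<Rightarrow> bool" where
  "contact e f v N \<longleftrightarrow>
    (\<forall>b. ereal (v - real b * e) \<le> \<nu> (hasse_deriv b f)) \<and>
    \<nu> (hasse_deriv N f) = ereal (v - real N * e) \<and>
    (\<forall>b>N. ereal (v - real b * e) < \<nu> (hasse_deriv b f))"

lemma contactD:
  assumes "contact e f v N"
  shows "ereal (v - real b * e) \<le> \<nu> (hasse_deriv b f)"
    and "\<nu> (hasse_deriv N f) = ereal (v - real N * e)"
    and "b > N \<Longrightarrow> ereal (v - real b * e) < \<nu> (hasse_deriv b f)"
  using assms by (auto simp: contact_def)

text \<open>All terms of the Leibniz sum lie on or above the line for v + w. In the sum of order N +
  M every index i other than N has i > N or N + M - i > M, so exactly one term lies on the line and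
  nothing cancels it.\<close>

lemma contact_mult:
  assumes f: "contact e f v N" and g: "contact e g w M"
  shows "contact e (f * g) (v + w) (N + M)"
proof -
  have eq: "(v - real i * e) + (w - real (b - i) * e) = v + w - real b * e" if "i \<le> b" for i b
    using that by (simp add: of_nat_diff algebra_simps)
  have ge: "ereal (v + w - real b * e) \<le> \<nu> (hasse_deriv i f * hasse_deriv (b - i) g)"
    if "i \<le> b" for i b
    using val_mult_ge[OF contactD(1)[OF f] contactD(1)[OF g]] eq[OF that] by metis
  have gt: "ereal (v + w - real b * e) < \<nu> (hasse_deriv i f * hasse_deriv (b - i) g)"
    if "i \<le> b" "N < i \<or> M < b - i" for i b
    using that(2)
  proof
    assume "N < i"
    from val_mult_gt[OF contactD(3)[OF f this] contactD(1)[OF g]] eq[OF that(1)]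
    show ?thesis by metis
  next
    assume "M < b - i"
    from val_mult_gt'[OF contactD(1)[OF f] contactD(3)[OF g this]] eq[OF that(1)]
    show ?thesis by metis
  qed
  have "\<nu> (hasse_deriv N f * hasse_deriv (N + M - N) g) = ereal (v + w - real (N + M) * e)"
    using contactD(2)[OF f] contactD(2)[OF g] by (simp add: val_mult algebra_simps)
  then have "\<nu> (hasse_deriv (N + M) (f * g)) = ereal (v + w - real (N + M) * e)"
    unfolding hasse_deriv_mult
  proof (rule val_sum_eq[rotated 2])
    show "ereal (v + w - real (N + M) * e) < \<nu> (hasse_deriv j f * hasse_deriv (N + M - j) g)"
      if "j \<in> {..N + M}" "j \<noteq> N" for j
      using that by (intro gt) auto
  qed auto
  moreover have "ereal (v + w - real b * e) < \<nu> (hasse_deriv b (f * g))" if "b > N + M" for b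
    unfolding hasse_deriv_mult using that by (intro val_sum_gt gt) auto
  moreover have "ereal (v + w - real b * e) \<le> \<nu> (hasse_deriv b (f * g))" for b
    unfolding hasse_deriv_mult by (intro val_sum_ge ge) auto
  ultimately show ?thesis
    by (simp add: contact_def)
qed

lemma contact_power: "contact e f v N \<Longrightarrow> contact e (f ^ j) (real j * v) (j * N)"
proof (induction j)
  case 0
  have "ereal (- (real b * e)) \<le> \<nu> (hasse_deriv b 1)" for b
    by (cases "b = 0") (simp_all add: hasse_deriv_eq_0)
  then show ?case
    by (simp add: contact_def hasse_deriv_eq_0)
next
  case (Suc j)
  then show ?case
    using contact_mult[of e f v N "f ^ j" "real j * v" "j * N"] by (simp add: algebra_simps)
qed

section \<open>Key polynomials of finite value\<close>

definition finite_key :: "'k Ky \<Rightarrow> bool" where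
  "finite_key Q \<longleftrightarrow> key_polynomial \<nu> Q \<and> degree Q > 0 \<and> \<nu> Q \<noteq> \<infinity>"

text \<open>Minimality of \<open>degree Q\<close> gives \<open>epsilon\<close> of h strictly below
  e. This excludes infinite value and, with strict inequality at every positive order, leaves order
  0 as the only contact.\<close>

lemma key_low_degree:
  assumes Q: "key_polynomial \<nu> Q" and e: "epsilon \<nu> Q = ereal e"
    and h: "h \<noteq> 0" "degree h < degree Q"
  obtains v where "\<nu> h = ereal v" "contact e h v 0"
proof -
  have lt: "epsilon \<nu> h < ereal e"
    using Q h e by (auto simp: key_polynomial_def not_le[symmetric])
  then have "\<nu> h \<noteq> \<infinity>"
    using epsilon_infinite[of h] h(1) by auto
  then obtain v where v: "\<nu> h = ereal v"
    by (rule val_finiteE)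
  have "ereal (v - real b * e) < \<nu> (hasse_deriv b h)" if "b > 0" for b
    using val_hasse_gt[OF lt v, of b] that by simp
  moreover from this have "ereal (v - real b * e) \<le> \<nu> (hasse_deriv b h)" for b
    using v by (cases "b = 0") (auto simp: less_imp_le)
  ultimately have "contact e h v 0"
    using v by (simp add: contact_def)
  with v show ?thesis by (rule that)
qed

text \<open>\<open>B\<close> is the largest order that computes \<open>epsilon\<close>; it is
  positive because the supremum is attained at some order b \<ge> 1.\<close>

lemma key_contact:
  assumes "finite_key Q"
  obtains e q B where "\<nu> Q = ereal q" "epsilon \<nu> Q = ereal e" "1 \<le> B" "contact e Q q B"
proof -
  obtain q where q: "\<nu> Q = ereal q"
    using assms by (auto simp: finite_key_def elim: val_finiteE)
  have "lead_coeff Q = 1" "degree Q > 0"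
    using assms by (auto simp: finite_key_def key_polynomial_def)
  then obtain b e where b: "1 \<le> b" "epsilon \<nu> Q = ereal e"
      "\<nu> (hasse_deriv b Q) = ereal (q - real b * e)"
    using epsilon_attained q by metis
  define S where "S = {b. \<nu> (hasse_deriv b Q) = ereal (q - real b * e)}"
  have "i \<le> degree Q" if "i \<in> S" for i
    using that hasse_deriv_eq_0[of Q i] by (cases "i \<le> degree Q") (auto simp: S_def)
  then have fin: "finite S"
    by (auto intro: finite_subset[of _ "{..degree Q}"])
  define B where "B = Max S"
  have "b \<in> S" using b by (simp add: S_def)
  then have "B \<in> S" "b \<le> B"
    using Max_in[OF fin] Max_ge[OF fin] unfolding B_def by blast+
  have notS: "i \<notin> S" if "i > B" for i
    using that Max_ge[OF fin, of i] unfolding B_def by (meson leD)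
  have ge: "ereal (q - real i * e) \<le> \<nu> (hasse_deriv i Q)" for i
    using val_hasse_ge[OF _ q, of e i] b(2) q by (cases "i = 0") auto
  have "contact e Q q B"
    unfolding contact_def
  proof (intro conjI allI impI ge)
    show "\<nu> (hasse_deriv B Q) = ereal (q - real B * e)"
      using \<open>B \<in> S\<close> by (simp add: S_def)
    show "ereal (q - real i * e) < \<nu> (hasse_deriv i Q)" if "i > B" for i
      using ge[of i] notS[OF that] by (auto simp: S_def less_le)
  qed
  with q b \<open>b \<le> B\<close> show ?thesis
    by (intro that[of q e B]) auto
qed

text \<open>Reduction modulo \<open>Q\<close> preserves values of products of two polynomials of low
  degree. If the multiple of \<open>Q\<close> had value at most that of f g, compare derivatives of
  order \<open>B\<close>: that multiple touches its line there, whereas f g and the remainder touch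
  theirs only at order 0.\<close>

lemma key_mult_mod:
  assumes Q: "finite_key Q"
    and f: "f \<noteq> 0" "degree f < degree Q" and g: "g \<noteq> 0" "degree g < degree Q"
  shows "\<nu> (f * g) < \<nu> (f * g div Q * Q)" "\<nu> (f * g mod Q) = \<nu> (f * g)"
    "f * g mod Q \<noteq> 0"
proof -
  have kQ: "key_polynomial \<nu> Q" "degree Q > 0"
    using Q by (auto simp: finite_key_def)
  obtain e q B where B: "\<nu> Q = ereal q" "epsilon \<nu> Q = ereal e" "1 \<le> B" "contact e Q q B"
    using key_contact[OF Q] .
  obtain v where v: "\<nu> f = ereal v" "contact e f v 0"
    using key_low_degree[OF kQ(1) B(2) f] .
  obtain w where w: "\<nu> g = ereal w" "contact e g w 0"
    using key_low_degree[OF kQ(1) B(2) g] .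
  have fg: "contact e (f * g) (v + w) 0"
    using contact_mult[OF v(2) w(2)] by simp
  have vfg: "\<nu> (f * g) = ereal (v + w)"
    by (simp add: val_mult v w)
  define a r where "a = f * g div Q" and "r = f * g mod Q"
  have ar: "f * g = a * Q + r"
    by (simp add: a_def r_def)
  have degr: "degree r < degree Q"
    using degree_mod_less[of Q "f * g"] kQ(2) by (fastforce simp: r_def)
  show lt: "\<nu> (f * g) < \<nu> (f * g div Q * Q)"
  proof (rule ccontr)
    assume "\<not> ?thesis"
    then have le: "\<nu> (a * Q) \<le> ereal (v + w)"
      by (simp add: a_def vfg)
    then have "a \<noteq> 0" by auto
    \<comment> \<open>The product f g has degree below twice that of \<open>Q\<close>, so the
      quotient \<open>a\<close> has degree below that of \<open>Q\<close> and
      \<open>key_low_degree\<close> applies to it.\<close>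
    have "degree (a * Q) \<le> degree f + degree g \<or> degree (a * Q) < degree Q"
    proof -
      have "a * Q = f * g - r" using ar by simp
      then have "degree (a * Q) \<le> max (degree (f * g)) (degree r)"
        by (metis degree_diff_le_max)
      then show ?thesis
        using degree_mult_le[of f g] degr by linarith
    qed
    moreover have "degree (a * Q) = degree a + degree Q"
      using \<open>a \<noteq> 0\<close> kQ(2) by (intro degree_mult_eq) auto
    ultimately have "degree a < degree Q"
      using f g by linarith
    from key_low_degree[OF kQ(1) B(2) \<open>a \<noteq> 0\<close> this]
    obtain u where u: "\<nu> a = ereal u" "contact e a u 0" .
    define m where "m = u + q"
    have aQ: "contact e (a * Q) m B"
      using contact_mult[OF u(2) B(4)] by (simp add: m_def)
    have m: "\<nu> (a * Q) = ereal m" "m \<le> v + w"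
      using le by (simp_all add: val_mult u B m_def)
    have r: "r = f * g - a * Q"
      using ar by simp
    have "ereal m \<le> \<nu> r"
      using val_diff[of "f * g" "a * Q"] m vfg unfolding r by (auto simp: min_def split: if_splits)
    have dr: "ereal (m - real B * e) < \<nu> (hasse_deriv B r)"
    proof (cases "r = 0")
      case False
      from key_low_degree[OF kQ(1) B(2) False degr]
      obtain z where z: "\<nu> r = ereal z" "contact e r z 0" .
      have "ereal (z - real B * e) < \<nu> (hasse_deriv B r)"
        using contactD(3)[OF z(2), of B] B(3) by simp
      with z(1) \<open>ereal m \<le> \<nu> r\<close> show ?thesis
        by (rule_tac y = "ereal (z - real B * e)" in le_less_trans) auto
    qed simp
    have "ereal (v + w - real B * e) < \<nu> (hasse_deriv B (f * g))"
      using contactD(3)[OF fg, of B] B(3) by simp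
    then have "ereal (m - real B * e) < \<nu> (hasse_deriv B (f * g))"
      using m(2) by (rule_tac y = "ereal (v + w - real B * e)" in le_less_trans) auto
    moreover have "hasse_deriv B (a * Q) = hasse_deriv B (f * g) + - hasse_deriv B r"
      unfolding ar hasse_deriv_add by simp
    ultimately have "ereal (m - real B * e) < \<nu> (hasse_deriv B (a * Q))"
      using dr val_add_gt[of "ereal (m - real B * e)" "hasse_deriv B (f * g)" "- hasse_deriv B r"]
      by simp
    with contactD(2)[OF aQ] show False by simp
  qed
  have "\<nu> (f * g + - (a * Q)) = \<nu> (f * g)"
    using lt by (intro val_add_eq) (simp add: a_def)
  moreover have "f * g + - (a * Q) = r"
    by (simp add: ar)
  ultimately show "\<nu> (f * g mod Q) = \<nu> (f * g)"
    by (simp add: r_def)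
  then show "f * g mod Q \<noteq> 0"
    using vfg by auto
qed

text \<open>The coefficient touches only at order 0, so the last contact comes from the power of
  \<open>Q\<close>. For positive \<open>B\<close> it identifies the index j.\<close>

lemma key_expansion_contact:
  assumes Q: "finite_key Q" and B: "\<nu> Q = ereal q" "epsilon \<nu> Q = ereal e" "contact e Q q B"
    and c: "is_expansion Q f c" "c j \<noteq> 0"
  obtains v where "\<nu> (c j * Q ^ j) = ereal v" "contact e (c j * Q ^ j) v (j * B)"
proof -
  have kQ: "key_polynomial \<nu> Q"
    using Q by (auto simp: finite_key_def)
  obtain v where v: "\<nu> (c j) = ereal v" "contact e (c j) v 0"
    using key_low_degree[OF kQ B(2) c(2) is_expansion_degree[OF c(1)]] .
  have "contact e (c j * Q ^ j) (v + real j * q) (j * B)"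
    using contact_mult[OF v(2) contact_power[OF B(3)]] by simp
  moreover have "\<nu> (c j * Q ^ j) = ereal (v + real j * q)"
    by (simp add: val_mult val_power v B)
  ultimately show ?thesis
    using that by blast
qed

text \<open>This covers f of infinite value too: nonzero coefficients have degree below that of
  \<open>Q\<close>, hence finite value by \<open>key_low_degree\<close>.\<close>

lemma truncation_finite:
  assumes Q: "finite_key Q" and f: "f \<noteq> 0"
  shows "tr Q f \<noteq> \<infinity>"
proof -
  obtain e q B where B: "\<nu> Q = ereal q" "epsilon \<nu> Q = ereal e" "1 \<le> B" "contact e Q q B"
    using key_contact[OF Q] .
  obtain c where c: "is_expansion Q f c"
    using is_expansion_expansion Q by (auto simp: finite_key_def)
  obtain s where s: "c s \<noteq> 0"
    using is_expansion_top[OF c f] by blast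
  obtain v where "\<nu> (c s * Q ^ s) = ereal v"
    using key_expansion_contact[OF Q B(1,2,4) c s] by blast
  then show ?thesis
    using truncation_le[OF c, of s] by auto
qed

lemma truncation_not_MInf:
  assumes "degree Q > 0"
  shows "tr Q f \<noteq> -\<infinity>"
proof -
  obtain c where c: "is_expansion Q f c"
    using is_expansion_expansion[OF assms] by blast
  show ?thesis
    using truncation_attained[OF c] by (metis val_not_MInf)
qed

text \<open>Each term of the expansion stays above its own line of slope -e, and all these lines
  start at height at least v.\<close>

lemma val_hasse_ge_truncation:
  assumes Q: "finite_key Q" and e: "epsilon \<nu> Q = ereal e" and f: "tr Q f = ereal v"
  shows "ereal (v - real b * e) \<le> \<nu> (hasse_deriv b f)"
proof -
  obtain e' q B where "\<nu> Q = ereal q" "epsilon \<nu> Q = ereal e'" "1 \<le> B" "contact e' Q q B"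
    using key_contact[OF Q] .
  then have B: "\<nu> Q = ereal q" "epsilon \<nu> Q = ereal e" "1 \<le> B" "contact e Q q B"
    using e by auto
  obtain c where c: "is_expansion Q f c"
    using is_expansion_expansion Q by (auto simp: finite_key_def)
  obtain s where s: "f = (\<Sum>j\<le>s. c j * Q ^ j)"
    using is_expansion_sum[OF c] by blast
  have "ereal (v - real b * e) \<le> \<nu> (hasse_deriv b (c j * Q ^ j))" for j
  proof (cases "c j = 0")
    case False
    then obtain w where w: "\<nu> (c j * Q ^ j) = ereal w" "contact e (c j * Q ^ j) w (j * B)"
      using key_expansion_contact[OF Q B(1,2,4) c] by blast
    have "v \<le> w"
      using truncation_le[OF c, of j] w(1) f by simp
    then show ?thesis
      using contactD(1)[OF w(2), of b] by (rule_tac y = "ereal (w - real b * e)" in order_trans) auto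
  qed simp
  then show ?thesis
    by (subst s) (auto simp: hasse_deriv_sum intro!: val_sum_ge)
qed

text \<open>Comparing the derivatives of order \<open>l B\<close>, where \<open>l\<close> is the largest index at which the
  minimum is attained and \<open>B\<close> is the largest order that computes \<open>epsilon \<nu> Q\<close>, singles out one
  term of the expansion in every characteristic; the minimal choices would need Lucas' theorem.\<close>

lemma truncation_hasse:
  assumes Q: "finite_key Q" and e: "epsilon \<nu> Q = ereal e"
    and f: "tr Q f = ereal v" "tr Q f < \<nu> f"
  obtains b where "1 \<le> b" "b \<le> degree f" "\<nu> (hasse_deriv b f) = ereal (v - real b * e)"
proof -
  obtain e' q B where "\<nu> Q = ereal q" "epsilon \<nu> Q = ereal e'" "1 \<le> B" "contact e' Q q B"
    using key_contact[OF Q] .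
  then have B: "\<nu> Q = ereal q" "epsilon \<nu> Q = ereal e" "1 \<le> B" "contact e Q q B"
    using e by auto
  have "degree Q > 0" using Q by (simp add: finite_key_def)
  then obtain c where c: "is_expansion Q f c"
    using is_expansion_expansion by blast
  obtain s where s: "\<And>j. j > s \<Longrightarrow> c j = 0" "f = (\<Sum>j\<le>s. c j * Q ^ j)"
    using is_expansion_sum[OF c] by blast
  define S where "S = {j. \<nu> (c j * Q ^ j) = ereal v}"
  have S_le: "j \<le> s" if "j \<in> S" for j
    using that s(1)[of j] by (cases "j \<le> s") (auto simp: S_def)
  then have fin: "finite S"
    by (auto intro: finite_subset[of _ "{..s}"])
  obtain j where "tr Q f = \<nu> (c j * Q ^ j)"
    using truncation_attained[OF c] .
  then have "j \<in> S"
    using f(1) by (simp add: S_def)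
  define l where "l = Max S"
  have l: "l \<in> S"
    using Max_in[OF fin] \<open>j \<in> S\<close> unfolding l_def by blast
  have notS: "i \<notin> S" if "i > l" for i
    using that Max_ge[OF fin, of i] unfolding l_def by (meson leD)
  have gt: "ereal v < \<nu> (c i * Q ^ i)" if "i \<notin> S" for i
    using truncation_le[OF c, of i] f(1) that by (auto simp: S_def less_le)
  \<comment> \<open>If l were 0, the constant term would be the unique term of minimal value, and
    \<nu> would agree with its truncation on f.\<close>
  have "l \<noteq> 0"
  proof
    assume l0: "l = 0"
    have "\<nu> f = ereal v"
      unfolding s(2)
    proof (rule val_sum_eq[of _ 0])
      show "\<nu> (c 0 * Q ^ 0) = ereal v"
        using l by (simp add: S_def l0)
      show "ereal v < \<nu> (c j * Q ^ j)" if "j \<noteq> 0" for j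
        using notS[of j] that l0 by (intro gt) auto
    qed auto
    with f show False by simp
  qed
  have cl: "c l \<noteq> 0"
    using l by (auto simp: S_def)
  have "\<nu> (hasse_deriv (l * B) f) = ereal (v - real (l * B) * e)"
    unfolding s(2) hasse_deriv_sum
  proof (rule val_sum_eq[of _ l])
    show "l \<in> {..s}" using S_le[OF l] by simp
    obtain w where w: "\<nu> (c l * Q ^ l) = ereal w" "contact e (c l * Q ^ l) w (l * B)"
      using key_expansion_contact[OF Q B(1,2,4) c cl] .
    moreover have "w = v"
      using l w(1) by (simp add: S_def)
    ultimately show "\<nu> (hasse_deriv (l * B) (c l * Q ^ l)) = ereal (v - real (l * B) * e)"
      using contactD(2)[OF w(2)] by simp
    fix i assume "i \<noteq> l"
    show "ereal (v - real (l * B) * e) < \<nu> (hasse_deriv (l * B) (c i * Q ^ i))"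
    proof (cases "c i = 0")
      case False
      obtain w where w: "\<nu> (c i * Q ^ i) = ereal w" "contact e (c i * Q ^ i) w (i * B)"
        using key_expansion_contact[OF Q B(1,2,4) c False] .
      \<comment> \<open>For i < l the order l B is past the last contact i B; for i > l the whole
        line already starts strictly above v.\<close>
      show ?thesis
      proof (cases "i < l")
        case True
        then have "ereal (w - real (l * B) * e) < \<nu> (hasse_deriv (l * B) (c i * Q ^ i))"
          using B(3) by (intro contactD(3)[OF w(2)]) simp
        moreover have "v \<le> w"
          using truncation_le[OF c, of i] w(1) f(1) by simp
        ultimately show ?thesis
          by (rule_tac y = "ereal (w - real (l * B) * e)" in le_less_trans) auto
      next
        case False
        with \<open>i \<noteq> l\<close> have "v < w"
          using gt[OF notS[of i]] w(1) by simp
        then show ?thesis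
          using contactD(1)[OF w(2), of "l * B"]
          by (rule_tac y = "ereal (w - real (l * B) * e)" in less_le_trans) auto
      qed
    qed simp
  qed auto
  moreover from this have "l * B \<le> degree f"
    using hasse_deriv_eq_0[of f "l * B"] by (cases "l * B \<le> degree f") auto
  moreover have "1 \<le> l * B"
    using \<open>l \<noteq> 0\<close> B(3) by simp
  ultimately show ?thesis
    using that by blast
qed

subsection \<open>The successor of a key polynomial\<close>

lemma next_degree_Phi: "P \<in> Phi \<nu> Q \<Longrightarrow> degree P = next_degree \<nu> Q"
  by (simp add: Phi_def)

lemma Phi_D:
  assumes "P \<in> Phi \<nu> Q"
  shows "lead_coeff P = 1" "tr Q P < \<nu> P" "P \<noteq> 0"
  using assms by (auto simp: Phi_def)

lemma Phi_degree_ge: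
  assumes "P \<in> Phi \<nu> Q"
  shows "degree Q \<le> degree P"
  using truncation_low_degree[of P Q] Phi_D(2)[OF assms] by (cases "degree P < degree Q") auto

text \<open>If the leading coefficient \<open>u\<close> had positive degree, then multiplying \<open>P\<close> by \<open>Q div u\<close> and
  reducing every coefficient modulo \<open>Q\<close> would lower the degree without changing the initial form.\<close>

lemma Phi_lead_degree:
  assumes Q: "finite_key Q" and P: "P \<in> Phi \<nu> Q"
    and c: "is_expansion Q P c" and s: "P = (\<Sum>j\<le>s. c j * Q ^ j)" "c s \<noteq> 0"
      "\<And>j. j > s \<Longrightarrow> c j = 0" "degree P = degree (c s) + s * degree Q"
  shows "degree (c s) = 0"
proof (rule ccontr)
  assume nz: "degree (c s) \<noteq> 0"
  have degQ: "degree Q > 0" and kQ: "key_polynomial \<nu> Q"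
    using Q by (auto simp: finite_key_def)
  obtain e q B where B: "\<nu> Q = ereal q" "epsilon \<nu> Q = ereal e" "1 \<le> B" "contact e Q q B"
    using key_contact[OF Q] .
  have degc: "degree (c j) < degree Q" for j
    using is_expansion_degree[OF c] .
  define a where "a = Q div c s"
  have Qeq: "Q = a * c s + Q mod c s"
    by (simp add: a_def)
  have degr: "degree (Q mod c s) < degree (c s)"
    using degree_mod_less[of "c s" Q] s(2) nz by fastforce
  have "a \<noteq> 0"
    using Qeq degr degc[of s] by auto
  have acs: "a * c s = Q + - (Q mod c s)"
    using Qeq by (metis add_diff_cancel_right' diff_conv_add_uminus)
  have "degree (a * c s) = degree Q"
    unfolding acs using degr degc[of s] by (intro degree_add_eq_left) simp
  then have dega: "degree a < degree Q"
    using \<open>a \<noteq> 0\<close> s(2) nz by (simp add: degree_mult_eq)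
  define r where "r = (\<lambda>j. a * c j mod Q)"
  define t where "t = (\<lambda>j. a * c j div Q)"
  have rt: "a * c j = t j * Q + r j" for j
    by (simp add: r_def t_def)
  \<comment> \<open>Modulo \<open>Q\<close> the product of \<open>a\<close> and the leading
    coefficient is minus the remainder of \<open>Q\<close>, whose degree is smaller than that of the
    leading coefficient. This is where the degree drops.\<close>
  have "r s = - (Q mod c s) mod Q"
    unfolding r_def acs by (rule mod_add_self1)
  then have rs: "r s = - (Q mod c s)"
    using degr degc[of s] by (simp add: mod_poly_less)
  have "r s \<noteq> 0"
    using key_mult_mod(3)[OF Q \<open>a \<noteq> 0\<close> dega s(2) degc] by (simp add: r_def)
  define h where "h = (\<Sum>j\<le>s. r j * Q ^ j)"
  have degrj: "degree (r j) < degree Q" for j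
    using degree_mod_less[of Q "a * c j"] degQ by (fastforce simp: r_def)
  have h: "is_expansion Q h r"
    unfolding h_def using s(3) degrj by (intro is_expansion_sumI) (auto simp: r_def)
  have "degree h = degree (r s) + s * degree Q"
    unfolding h_def by (rule degree_expansion_sum[of r Q s, OF degrj \<open>r s \<noteq> 0\<close>])
  also have "\<dots> < degree P"
    using degr s(4) by (simp add: rs)
  finally have trh: "tr Q h = \<nu> h"
    using truncation_below_next_degree[OF degQ] next_degree_Phi[OF P] by simp
  obtain \<alpha> where \<alpha>: "\<nu> a = ereal \<alpha>"
    using key_low_degree[OF kQ B(2) \<open>a \<noteq> 0\<close> dega] .
  obtain v where v: "tr Q P = ereal v"
    using truncation_finite[OF Q Phi_D(3)[OF P]] truncation_not_MInf[OF degQ, of P]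
    by (cases "tr Q P") auto
  \<comment> \<open>\<alpha> + v is the value that a minimal term of the expansion of P acquires
    after multiplication by \<open>a\<close>. Both a P and the discarded multiples of
    \<open>Q\<close> exceed it, hence so does their difference h.\<close>
  have "ereal (\<alpha> + v) < \<nu> (a * P)"
    using val_mult_gt'[of \<alpha> a v P] \<alpha> Phi_D(2)[OF P] v by simp
  moreover have "ereal (\<alpha> + v) < \<nu> (\<Sum>j\<le>s. t j * Q ^ Suc j)"
  proof (rule val_sum_gt)
    fix j
    show "ereal (\<alpha> + v) < \<nu> (t j * Q ^ Suc j)"
    proof (cases "c j = 0")
      case False
      obtain w where w: "\<nu> (c j) = ereal w"
        using key_low_degree[OF kQ B(2) False degc] .
      have "v \<le> w + real j * q"
        using truncation_le[OF c, of j] v w B(1) by (simp add: val_mult val_power)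
      moreover have "ereal (\<alpha> + w) < \<nu> (t j * Q)"
        using key_mult_mod(1)[OF Q \<open>a \<noteq> 0\<close> dega False degc] \<alpha> w by (simp add: t_def val_mult)
      then have "ereal (\<alpha> + w + real j * q) < \<nu> ((t j * Q) * Q ^ j)"
        by (rule val_mult_gt) (simp add: val_power B)
      ultimately have "ereal (\<alpha> + v) < \<nu> ((t j * Q) * Q ^ j)"
        by (rule_tac y = "ereal (\<alpha> + w + real j * q)" in le_less_trans) auto
      then show ?thesis
        by (simp add: mult_ac)
    qed (simp add: t_def)
  qed simp
  moreover have "h = a * P + - (\<Sum>j\<le>s. t j * Q ^ Suc j)"
  proof -
    have "a * P = (\<Sum>j\<le>s. (a * c j) * Q ^ j)"
      by (subst s(1)) (simp add: sum_distrib_left mult_ac)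
    also have "\<dots> = (\<Sum>j\<le>s. t j * Q ^ Suc j) + h"
      unfolding rt h_def by (simp add: sum.distrib algebra_simps)
    finally show ?thesis by simp
  qed
  ultimately have gt: "ereal (\<alpha> + v) < \<nu> h"
    using val_add_gt[of "ereal (\<alpha> + v)" "a * P" "- (\<Sum>j\<le>s. t j * Q ^ Suc j)"] by simp
  \<comment> \<open>A term that attains the minimum for P survives reduction with value exactly
    \<alpha> + v, so the truncation of h is smaller than \<nu> h. But h has degree below
    \<open>next_degree\<close>.\<close>
  obtain j where j: "tr Q P = \<nu> (c j * Q ^ j)"
    using truncation_attained[OF c] .
  then have "c j \<noteq> 0"
    using v by auto
  from key_mult_mod(2)[OF Q \<open>a \<noteq> 0\<close> dega this degc]
  have "\<nu> (r j * Q ^ j) = ereal \<alpha> + \<nu> (c j * Q ^ j)"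
    by (simp add: r_def val_mult \<alpha> add.assoc)
  also have "\<dots> = ereal (\<alpha> + v)"
    by (simp add: v flip: j)
  finally have "\<nu> (r j * Q ^ j) = ereal (\<alpha> + v)" .
  with truncation_le[OF h, of j] gt trh show False
    by simp
qed

text \<open>By \<open>Phi_lead_degree\<close> the leading coefficient is a constant, hence 1 as P
  and \<open>Q\<close> are monic. The top power must attain the minimum: otherwise removing it
  leaves a polynomial of smaller degree whose truncation is still strictly smaller than its
  value.\<close>

lemma Phi_lower_bound:
  assumes Q: "finite_key Q" and P: "P \<in> Phi \<nu> Q"
  obtains s where "1 \<le> s" "tr Q P = \<nu> (Q ^ s)"
proof -
  have degQ: "degree Q > 0" and monic: "lead_coeff Q = 1"
    using Q by (auto simp: finite_key_def key_polynomial_def)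
  obtain c where c: "is_expansion Q P c"
    using is_expansion_expansion[OF degQ] by blast
  obtain s where s: "P = (\<Sum>j\<le>s. c j * Q ^ j)" "c s \<noteq> 0"
      "\<And>j. j > s \<Longrightarrow> c j = 0" "degree P = degree (c s) + s * degree Q"
    using is_expansion_top[OF c Phi_D(3)[OF P]] by blast
  have cs: "degree (c s) = 0"
    using Phi_lead_degree[OF Q P c s] .
  have "s \<noteq> 0"
    using Phi_degree_ge[OF P] s(4) cs degQ by (cases s) auto
  then obtain t where t: "s = Suc t"
    by (cases s) auto
  define h where "h = (\<Sum>j\<le>t. c j * Q ^ j)"
  have Ph: "P = h + c s * Q ^ s"
    using s(1) t by (simp add: h_def)
  have degh: "degree h < degree P"
    using degree_expansion_sum_less[of c Q t] is_expansion_degree[OF c] s(4) cs t by (simp add: h_def)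
  obtain a where a: "c s = [:a:]"
    using cs by (metis degree_0_id)
  have "1 = coeff P (degree P)"
    using Phi_D(1)[OF P] by simp
  also have "\<dots> = a * coeff (Q ^ s) (degree (Q ^ s))"
  proof -
    have "degree (Q ^ s) = degree P"
      using s(4) cs degQ by (subst degree_power_eq) auto
    then show ?thesis
      using coeff_eq_0[OF degh] a by (subst Ph) simp
  qed
  also have "\<dots> = a"
    using monic by (simp add: lead_coeff_power)
  finally have cs1: "c s = 1"
    using a by (simp add: one_pCons)
  have "tr Q P = \<nu> (c s * Q ^ s)"
  proof (rule ccontr)
    assume ne: "tr Q P \<noteq> \<nu> (c s * Q ^ s)"
    then have lt: "tr Q P < \<nu> (c s * Q ^ s)"
      using truncation_le[OF c, of s] by simp
    obtain j where j: "tr Q P = \<nu> (c j * Q ^ j)"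
      using truncation_attained[OF c] .
    have "j \<le> t"
    proof (rule ccontr)
      assume "\<not> j \<le> t"
      then have "j = s \<or> j > s" using t by auto
      then show False
        using j ne lt s(3)[of j] by auto
    qed
    have h: "is_expansion Q h (\<lambda>j. if j \<le> t then c j else 0)"
    proof -
      have "h = (\<Sum>j\<le>t. (if j \<le> t then c j else 0) * Q ^ j)"
        unfolding h_def by (intro sum.cong) auto
      also have "is_expansion Q \<dots> (\<lambda>j. if j \<le> t then c j else 0)"
        using is_expansion_degree[OF c] degQ by (intro is_expansion_sumI) auto
      finally show ?thesis .
    qed
    have "tr Q h \<le> tr Q P"
      using truncation_le[OF h, of j] j \<open>j \<le> t\<close> by simp
    also have "tr Q P < \<nu> h"
      using val_add_gt[of "tr Q P" P "- (c s * Q ^ s)"] Phi_D(2)[OF P] lt Ph by simp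
    also have "\<nu> h = tr Q h"
      using truncation_below_next_degree[OF degQ] degh next_degree_Phi[OF P] by simp
    finally show False by simp
  qed
  with cs1 \<open>s \<noteq> 0\<close> show ?thesis
    using that[of s] by simp
qed

text \<open>\<open>truncation_hasse\<close> makes \<open>epsilon\<close> of P exceed that of
  \<open>Q\<close>, while every nonzero polynomial of smaller degree equals its truncation in value
  and so has \<open>epsilon\<close> at most that of \<open>Q\<close>.\<close>

lemma Phi_key:
  assumes Q: "finite_key Q" and P: "P \<in> Phi \<nu> Q"
  shows "key_polynomial \<nu> P"
proof -
  have degQ: "degree Q > 0"
    using Q by (auto simp: finite_key_def key_polynomial_def)
  obtain e q B where B: "\<nu> Q = ereal q" "epsilon \<nu> Q = ereal e" "1 \<le> B" "contact e Q q B"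
    using key_contact[OF Q] .
  obtain v where v: "tr Q P = ereal v"
    using truncation_finite[OF Q Phi_D(3)[OF P]] truncation_not_MInf[OF degQ, of P]
    by (cases "tr Q P") auto
  obtain b where b: "1 \<le> b" "\<nu> (hasse_deriv b P) = ereal (v - real b * e)"
    using truncation_hasse[OF Q B(2) v Phi_D(2)[OF P]] by blast
  have epsP: "ereal e < epsilon \<nu> P"
    using epsilon_gtI[OF b] Phi_D(2)[OF P] v by simp
  have "degree P \<le> degree f" if f: "f \<noteq> 0" "epsilon \<nu> P \<le> epsilon \<nu> f" for f
  proof (rule ccontr)
    assume "\<not> ?thesis"
    then have tr: "tr Q f = \<nu> f"
      using truncation_below_next_degree[OF degQ] next_degree_Phi[OF P] by simp
    then obtain w where w: "\<nu> f = ereal w"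
      using truncation_finite[OF Q f(1)] by (auto elim: val_finiteE)
    have "epsilon \<nu> f \<le> ereal e"
      using w tr by (intro epsilon_leI val_hasse_ge_truncation[OF Q B(2)]) auto
    with epsP f(2) show False by auto
  qed
  moreover have "\<nu> y_var \<le> \<nu> P"
  proof -
    \<comment> \<open>Since \<open>Q\<close> has nonnegative value, its power of exponent s \<ge> 1
      has at least the value of \<open>Q\<close>.\<close>
    obtain s where s: "1 \<le> s" "tr Q P = \<nu> (Q ^ s)"
      using Phi_lower_bound[OF Q P] .
    have yQ: "\<nu> y_var \<le> \<nu> Q"
      using Q by (simp add: finite_key_def key_polynomial_def)
    then have "0 \<le> q"
      using val_y B(1) by (metis ereal_less_eq(3) one_ereal_def order_trans zero_le_one)
    then have "q \<le> real s * q"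
      using s(1) mult_right_mono[of 1 "real s" q] by simp
    then have "\<nu> Q \<le> tr Q P"
      using s(2) B(1) by (simp add: val_power)
    with yQ Phi_D(2)[OF P] show ?thesis
      by (meson less_imp_le order_trans)
  qed
  ultimately show ?thesis
    using Phi_D(1)[OF P] by (auto simp: key_polynomial_def)
qed

text \<open>Constants have \<open>epsilon\<close> equal to -\<infinity>, whereas that of y is
  real.\<close>

lemma key_polynomial_y:
  assumes "\<nu> y_var \<noteq> \<infinity>"
  shows "key_polynomial \<nu> y_var"
proof -
  obtain q where q: "\<nu> y_var = ereal q"
    using assms by (rule val_finiteE)
  obtain e where e: "epsilon \<nu> y_var = ereal e"
    using epsilon_attained[OF _ _ q] by (auto simp: one_pCons)
  have "degree (y_var :: 'k Ky) \<le> degree f" if "epsilon \<nu> y_var \<le> epsilon \<nu> f" for f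
    using that e epsilon_const[of f] by (cases "degree f = 0") auto
  then show ?thesis
    by (simp add: key_polynomial_def)
qed

text \<open>P = Q + (P - Q) is already the expansion of P, so its truncation is the smaller of the
  two values. Unequal values would make this the value of P.\<close>

lemma Phi_same_degree:
  assumes Q: "degree Q > 0" "lead_coeff Q = 1" and P: "P \<in> Phi \<nu> Q" "degree P = degree Q"
  shows "degree (P - Q) < degree Q" "\<nu> (P - Q) = \<nu> Q" "\<nu> Q < \<nu> P"
proof -
  show deg: "degree (P - Q) < degree Q"
    using degree_diff_monic_less[OF P(2) Phi_D(1)[OF P(1)] Q(2,1)] .
  have tr: "min (\<nu> Q) (\<nu> (P - Q)) < \<nu> P"
    using truncation_affine[OF deg] Phi_D(2)[OF P(1)] by simp
  show eq: "\<nu> (P - Q) = \<nu> Q"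
  proof (rule ccontr)
    assume "\<not> ?thesis"
    then consider "\<nu> Q < \<nu> (P - Q)" | "\<nu> (P - Q) < \<nu> Q"
      by (auto simp: neq_iff)
    then show False
    proof cases
      case 1
      then show False using val_add_eq[OF 1] tr by simp
    next
      case 2
      then show False using val_add_eq[OF 2] tr by simp
    qed
  qed
  show "\<nu> Q < \<nu> P"
    using tr eq by simp
qed

end

subsection \<open>Completeness\<close>

lemma group_closure_mono: "A \<subseteq> B \<Longrightarrow> group_closure A \<subseteq> group_closure B"
proof
  fix x assume "A \<subseteq> B" "x \<in> group_closure A"
  from this(2,1) show "x \<in> group_closure B"
    by (induction rule: group_closure.induct) (auto intro: group_closure.intros)
qed

lemma group_closure_sum:
  "(\<And>i. i \<in> I \<Longrightarrow> f i \<in> group_closure A) \<Longrightarrow> (\<Sum>i\<in>I. f i) \<in> group_closure A"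
  by (induction I rule: infinite_finite_induct) (auto intro: group_closure_add)

text \<open>Each translate of the integers meets a bounded interval in a finite set, so a bounded
  sequence of this kind would take finitely many values, against injectivity.\<close>

lemma strict_mono_unbounded:
  fixes x :: "nat \<Rightarrow> real"
  assumes "strict_mono x" "finite F" "\<And>k. \<exists>c\<in>F. \<exists>z::int. x k = of_int z + c"
  shows "\<exists>k. x k > C"
proof (rule ccontr)
  assume "\<not> ?thesis"
  then have le: "x k \<le> C" for k
    by (simp add: not_less)
  have "range x \<subseteq> (\<Union>c\<in>F. (\<lambda>z. of_int z + c) ` {\<lfloor>x 0 - c\<rfloor>..\<lfloor>C - c\<rfloor>})"
  proof (rule image_subsetI)
    fix k
    obtain c z where c: "c \<in> F" "x k = of_int z + c"
      using assms(3) by blast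
    have "x 0 \<le> x k"
      using assms(1) by (simp add: strict_mono_less_eq)
    with c le[of k] have "\<lfloor>x 0 - c\<rfloor> \<le> z" "z \<le> \<lfloor>C - c\<rfloor>"
      by linarith+
    then have "x k \<in> (\<lambda>z. of_int z + c) ` {\<lfloor>x 0 - c\<rfloor>..\<lfloor>C - c\<rfloor>}"
      unfolding c(2) by (intro imageI) simp
    with c(1) show "x k \<in> (\<Union>c\<in>F. (\<lambda>z. of_int z + c) ` {\<lfloor>x 0 - c\<rfloor>..\<lfloor>C - c\<rfloor>})"
      by blast
  qed
  then have "finite (range x)"
    by (rule finite_subset) (use assms(2) in simp)
  moreover have "inj x"
    using assms(1) by (rule strict_mono_imp_inj_on)
  ultimately show False
    using finite_imageD[of x UNIV] by simp
qed

section \<open>Groups generated by monomials\<close>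

context Vx_valuation
begin

text \<open>The generators in \<open>complete_for\<close>, with the index set as a parameter so that
  initial segments of a run can be treated.\<close>

definition monomials :: "'i set \<Rightarrow> ('i \<Rightarrow> 'k Ky) \<Rightarrow> ereal \<Rightarrow> 'k Ky set" where
  "monomials I Q \<beta> = {[:a:] * (\<Prod>i\<in>S. Q i ^ \<gamma> i) | a S \<gamma>.
     finite S \<and> S \<subseteq> I \<and> \<nu> [:a:] + (\<Sum>i\<in>S. ereal (real (\<gamma> i)) * \<nu> (Q i)) \<ge> \<beta>}"

lemma monomialsI:
  "finite S \<Longrightarrow> S \<subseteq> I \<Longrightarrow> \<beta> \<le> \<nu> [:a:] + (\<Sum>i\<in>S. ereal (real (\<gamma> i)) * \<nu> (Q i)) \<Longrightarrow>
    [:a:] * (\<Prod>i\<in>S. Q i ^ \<gamma> i) \<in> monomials I Q \<beta>"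
  unfolding monomials_def by blast

lemma monomialsE:
  assumes "f \<in> monomials I Q \<beta>"
  obtains a S \<gamma> where "f = [:a:] * (\<Prod>i\<in>S. Q i ^ \<gamma> i)" "finite S" "S \<subseteq> I"
    "\<beta> \<le> \<nu> [:a:] + (\<Sum>i\<in>S. ereal (real (\<gamma> i)) * \<nu> (Q i))"
  using assms unfolding monomials_def by blast

lemma monomials_mono: "I \<subseteq> J \<Longrightarrow> \<alpha> \<le> \<beta> \<Longrightarrow> monomials I Q \<beta> \<subseteq> monomials J Q \<alpha>"
  unfolding monomials_def by (blast intro: order_trans)

lemma monomials_val: "f \<in> monomials I Q \<beta> \<Longrightarrow> \<beta> \<le> \<nu> f"
  by (erule monomialsE) (simp only: val_mult val_prod val_power)

lemma group_closure_monomials_val: "f \<in> group_closure (monomials I Q \<beta>) \<Longrightarrow> \<beta> \<le> \<nu> f"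
proof (induction rule: group_closure.induct)
  case (base s)
  then show ?case using monomials_val by auto
next
  case (diff s t)
  then show ?case using val_diff[of s t] by (auto simp: min_def split: if_splits)
qed

lemma monomials_mult:
  assumes "f \<in> monomials I Q \<beta>" "n \<notin> I"
  shows "f * Q n ^ j \<in> monomials (insert n I) Q (\<beta> + \<nu> (Q n ^ j))"
proof -
  obtain a S \<gamma> where f: "f = [:a:] * (\<Prod>i\<in>S. Q i ^ \<gamma> i)" "finite S" "S \<subseteq> I"
    "\<beta> \<le> \<nu> [:a:] + (\<Sum>i\<in>S. ereal (real (\<gamma> i)) * \<nu> (Q i))"
    using assms(1) by (rule monomialsE)
  \<comment> \<open>As n lies outside I, this update overwrites no exponent in use.\<close>
  define \<gamma>' where "\<gamma>' = \<gamma>(n := j)"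
  have n: "n \<notin> S" using assms(2) f(3) by blast
  have "(\<Prod>i\<in>insert n S. Q i ^ \<gamma>' i) = Q n ^ j * (\<Prod>i\<in>S. Q i ^ \<gamma> i)"
    using n f(2) by (simp add: \<gamma>'_def) (rule disjI2, rule prod.cong, auto)
  moreover have "(\<Sum>i\<in>insert n S. ereal (real (\<gamma>' i)) * \<nu> (Q i)) =
      ereal (real j) * \<nu> (Q n) + (\<Sum>i\<in>S. ereal (real (\<gamma> i)) * \<nu> (Q i))"
    using n f(2) by (simp add: \<gamma>'_def) (rule arg_cong[where f = "(+) _"], rule sum.cong, auto)
  moreover have "\<beta> + ereal (real j) * \<nu> (Q n) \<le>
      \<nu> [:a:] + (ereal (real j) * \<nu> (Q n) + (\<Sum>i\<in>S. ereal (real (\<gamma> i)) * \<nu> (Q i)))"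
    using add_right_mono[OF f(4), of "ereal (real j) * \<nu> (Q n)"] by (simp add: add_ac)
  ultimately have "[:a:] * (Q n ^ j * (\<Prod>i\<in>S. Q i ^ \<gamma> i)) \<in>
      monomials (insert n I) Q (\<beta> + \<nu> (Q n ^ j))"
    using monomialsI[of "insert n S" "insert n I" "\<beta> + \<nu> (Q n ^ j)" a \<gamma>' Q] f(2,3)
    by (auto simp: val_power)
  then show ?thesis
    by (simp add: f(1) mult_ac)
qed

lemma group_closure_monomials_mult:
  assumes "f \<in> group_closure (monomials I Q \<beta>)" "n \<notin> I"
  shows "f * Q n ^ j \<in> group_closure (monomials (insert n I) Q (\<beta> + \<nu> (Q n ^ j)))"
  using assms(1)
proof (induction rule: group_closure.induct)
  case (base s)
  then show ?case
    using monomials_mult[OF _ assms(2)] by (auto intro: group_closure.base)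
next
  case (diff s t)
  then show ?case
    by (auto simp: left_diff_distrib intro: group_closure.diff)
qed

lemma group_closure_monomials_mono:
  "f \<in> group_closure (monomials I Q \<beta>) \<Longrightarrow> I \<subseteq> J \<Longrightarrow> \<alpha> \<le> \<beta> \<Longrightarrow>
    f \<in> group_closure (monomials J Q \<alpha>)"
  using group_closure_mono[OF monomials_mono] by blast

lemma complete_for_iff:
  "complete_for \<nu> I Q \<longleftrightarrow> (\<forall>i\<in>I. key_polynomial \<nu> (Q i)) \<and>
    (\<forall>\<beta>\<in>value_group \<nu>. {f. \<beta> \<le> \<nu> f} = group_closure (monomials I Q \<beta>))"
  by (simp add: complete_for_def monomials_def)

lemma complete_forI:
  assumes "\<And>i. i \<in> I \<Longrightarrow> key_polynomial \<nu> (Q i)"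
    and "\<And>\<beta> f. \<beta> \<le> \<nu> f \<Longrightarrow> f \<in> group_closure (monomials I Q \<beta>)"
  shows "complete_for \<nu> I Q"
  unfolding complete_for_iff
proof (intro conjI ballI set_eqI iffI)
  fix \<beta> f
  assume "f \<in> group_closure (monomials I Q \<beta>)"
  then show "f \<in> {f. \<beta> \<le> \<nu> f}"
    using group_closure_monomials_val by simp
qed (use assms in auto)

end

section \<open>Runs that do not stop\<close>

locale nonstopping_run = Vx_valuation \<nu> for \<nu> :: "'k::field Ky \<Rightarrow> ereal" +
  fixes Q :: "nat \<Rightarrow> 'k Ky"
  assumes run: "infinite_run \<nu> Q"
begin

lemma Q_1: "Q (Suc 0) = y_var"
  using run by (simp add: infinite_run_def)

lemma Q_Phi: "1 \<le> n \<Longrightarrow> Q (Suc n) \<in> Phi \<nu> (Q n)"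
  using run by (simp add: infinite_run_def)

lemma val_Q_Suc: "1 \<le> n \<Longrightarrow> \<nu> (Q (Suc n)) = Inf (Psi \<nu> (Q n))"
  using run by (simp add: infinite_run_def next_beta_def)

lemma val_Q_finite: "1 \<le> n \<Longrightarrow> degree (Q n) > 0 \<Longrightarrow> \<nu> (Q n) \<noteq> \<infinity>"
  using run truncation_infinite[of "Q n"] by (auto simp: infinite_run_def)

lemma finite_key_Q: "1 \<le> n \<Longrightarrow> finite_key (Q n)"
proof (induction n rule: dec_induct)
  case base
  have "\<nu> y_var \<noteq> \<infinity>"
    using val_Q_finite[of 1] Q_1 by simp
  then show ?case
    using key_polynomial_y Q_1 by (simp add: finite_key_def)
next
  case (step n)
  have "degree (Q (Suc n)) > 0"
    using Phi_degree_ge[OF Q_Phi[OF step(1)]] step(3) by (simp add: finite_key_def)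
  with step Phi_key[OF step(3) Q_Phi] val_Q_finite[of "Suc n"] show ?case
    by (simp add: finite_key_def)
qed

lemma Q_facts:
  assumes "1 \<le> n"
  shows "degree (Q n) > 0" "lead_coeff (Q n) = 1" "key_polynomial \<nu> (Q n)" "\<nu> (Q n) \<noteq> \<infinity>"
  using finite_key_Q[OF assms] by (auto simp: finite_key_def key_polynomial_def)

lemma degree_Q_Suc: "1 \<le> n \<Longrightarrow> degree (Q (Suc n)) = next_degree \<nu> (Q n)"
  using next_degree_Phi[OF Q_Phi] .

lemma truncation_below:
  "1 \<le> n \<Longrightarrow> degree f < degree (Q (Suc n)) \<Longrightarrow> tr (Q n) f = \<nu> f"
  using truncation_below_next_degree[OF Q_facts(1)] degree_Q_Suc by simp

text \<open>Expand in powers of the last key polynomial. The coefficients have smaller degree, so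
  \<nu> equals the preceding truncation on them and the induction hypothesis generates them at their
  exact value.\<close>

lemma generated_by_initial_segment:
  "1 \<le> n \<Longrightarrow> \<beta> \<le> tr (Q n) f \<Longrightarrow> f \<in> group_closure (monomials {1..n} Q \<beta>)"
proof (induction n arbitrary: f \<beta> rule: dec_induct)
  \<comment> \<open>One expansion step, shared by both cases of the induction; in the base case I is
    empty and the coefficients are constants.\<close>
  have *: "f \<in> group_closure (monomials (insert n I) Q \<beta>)"
    if n: "1 \<le> n" "n \<notin> I" "\<beta> \<le> tr (Q n) f"
      and IH: "\<And>g. degree g < degree (Q n) \<Longrightarrow> g \<in> group_closure (monomials I Q (\<nu> g))"
    for f \<beta> n I
  proof -
    obtain c where c: "is_expansion (Q n) f c"
      using is_expansion_expansion[OF Q_facts(1)[OF n(1)]] by blast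
    obtain s where s: "f = (\<Sum>j\<le>s. c j * Q n ^ j)"
      using is_expansion_sum[OF c] by blast
    have "c j * Q n ^ j \<in> group_closure (monomials (insert n I) Q \<beta>)" for j
    proof (rule group_closure_monomials_mono)
      show "c j * Q n ^ j \<in> group_closure (monomials (insert n I) Q (\<nu> (c j) + \<nu> (Q n ^ j)))"
        using group_closure_monomials_mult[OF IH[OF is_expansion_degree[OF c]] n(2)] .
      show "\<beta> \<le> \<nu> (c j) + \<nu> (Q n ^ j)"
        using order_trans[OF n(3) truncation_le[OF c]] by (simp add: val_mult)
    qed simp
    then show ?thesis
      by (subst s) (rule group_closure_sum)
  qed
  {
    case base
    have "g \<in> group_closure (monomials {} Q (\<nu> g))" if "degree g < degree (Q 1)" for g
    proof -
      have "degree g = 0"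
        using that Q_1 by simp
      then obtain a where a: "g = [:a:]"
        by (metis degree_0_id)
      then have "g \<in> monomials {} Q (\<nu> g)"
        using monomialsI[of "{}" "{}" "\<nu> g" a "\<lambda>_. 0" Q] by simp
      then show ?thesis
        by (auto intro: group_closure.base)
    qed
    from *[of 1 "{}", OF _ _ base this] show ?case by simp
  next
    case (step n)
    have "g \<in> group_closure (monomials {1..n} Q (\<nu> g))" if "degree g < degree (Q (Suc n))" for g
      using step.IH[of "\<nu> g" g] truncation_below[OF step.hyps(1) that] by simp
    from *[of "Suc n" "{1..n}", OF _ _ step.prems this] show ?case
      by (simp add: atLeastAtMostSuc_conv)
  }
qed

text \<open>By induction the coefficients of an expansion take values in finitely many translates of
  the integers. Bounded degree leaves finitely many exponents, so only finitely many further
  translates arise.\<close>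

lemma truncation_discrete:
  "1 \<le> n \<Longrightarrow> \<exists>F. finite F \<and> (\<forall>f. f \<noteq> 0 \<longrightarrow> degree f \<le> D \<longrightarrow>
    (\<exists>c\<in>F. \<exists>z::int. tr (Q n) f = ereal (of_int z + c)))"
proof (induction n arbitrary: D rule: dec_induct)
  have *: "\<exists>F'. finite F' \<and> (\<forall>f. f \<noteq> 0 \<longrightarrow> degree f \<le> D \<longrightarrow>
      (\<exists>c\<in>F'. \<exists>z::int. tr (Q n) f = ereal (of_int z + c)))"
    if n: "1 \<le> n" and F: "finite F" "\<And>g. g \<noteq> 0 \<Longrightarrow> degree g < degree (Q n) \<Longrightarrow>
        \<exists>c\<in>F. \<exists>z::int. \<nu> g = ereal (of_int z + c)"
    for n F D
  proof -
    obtain q where q: "\<nu> (Q n) = ereal q"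
      using Q_facts(4)[OF n] by (rule val_finiteE)
    \<comment> \<open>\<open>Q n\<close> has degree at least 1, so no exponent in the expansion
      exceeds the degree bound \<open>D\<close>.\<close>
    define F' where "F' = (\<lambda>(c, j). c + real j * q) ` (F \<times> {..D})"
    have "\<exists>c\<in>F'. \<exists>z::int. tr (Q n) f = ereal (of_int z + c)"
      if f: "f \<noteq> 0" "degree f \<le> D" for f
    proof -
      obtain c where c: "is_expansion (Q n) f c"
        using is_expansion_expansion[OF Q_facts(1)[OF n]] by blast
      obtain s where s: "\<And>j. j > s \<Longrightarrow> c j = 0" "degree f = degree (c s) + s * degree (Q n)"
        using is_expansion_top[OF c f(1)] by metis
      obtain j where j: "tr (Q n) f = \<nu> (c j * Q n ^ j)"
        using truncation_attained[OF c] .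
      have cj: "c j \<noteq> 0"
        using j truncation_finite[OF finite_key_Q[OF n] f(1)] by auto
      have "s \<le> s * degree (Q n)"
        using Q_facts(1)[OF n] by simp
      moreover have "j \<le> s"
        using s(1)[of j] cj by (cases "j \<le> s") auto
      ultimately have "j \<le> D"
        using s(2) f(2) by linarith
      obtain c0 z where c0: "c0 \<in> F" "\<nu> (c j) = ereal (of_int z + c0)"
        using F(2)[OF cj is_expansion_degree[OF c]] by blast
      have "tr (Q n) f = ereal (of_int z + (c0 + real j * q))"
        using j c0 q by (simp add: val_mult val_power)
      moreover have "c0 + real j * q \<in> F'"
        unfolding F'_def using c0(1) \<open>j \<le> D\<close> by (intro image_eqI[of _ _ "(c0, j)"]) auto
      ultimately show ?thesis by blast
    qed
    moreover have "finite F'"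
      using F(1) by (simp add: F'_def)
    ultimately show ?thesis by blast
  qed
  {
    case base
    have "\<exists>c\<in>{0}. \<exists>z::int. \<nu> g = ereal (of_int z + c)" if "g \<noteq> 0" "degree g < degree (Q 1)" for g
    proof -
      have "degree g = 0"
        using that Q_1 by simp
      then obtain a where a: "g = [:a:]"
        by (metis degree_0_id)
      with that(1) have "a \<noteq> 0" by simp
      then obtain z where "\<nu> [:a:] = ereal (of_int z)"
        by (rule val_const)
      with a show ?thesis by auto
    qed
    from *[of 1 "{0}", OF _ _ this] show ?case by simp
  next
    case (step n)
    obtain F where F: "finite F" "\<forall>f. f \<noteq> 0 \<longrightarrow> degree f \<le> degree (Q (Suc n)) \<longrightarrow>
        (\<exists>c\<in>F. \<exists>z::int. tr (Q n) f = ereal (of_int z + c))"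
      using step.IH by blast
    have "\<exists>c\<in>F. \<exists>z::int. \<nu> g = ereal (of_int z + c)"
      if "g \<noteq> 0" "degree g < degree (Q (Suc n))" for g
    proof -
      have "\<exists>c\<in>F. \<exists>z::int. tr (Q n) g = ereal (of_int z + c)"
        using F(2) that by (meson less_imp_le)
      then show ?thesis
        by (simp add: truncation_below[OF step.hyps(1) that(2)])
    qed
    from *[of "Suc n" F, OF _ F(1) this] show ?case by simp
  }
qed

text \<open>Any P in \<open>Phi\<close> for \<open>Q n\<close> with value above the minimum differs
  from \<open>Q (Suc n)\<close> by lower degree, so its next truncation is at most the minimum. Thus
  P lies in the next \<open>Phi\<close> as well: the degree stays the same and only one value is
  lost.\<close>

lemma Psi_infinite_Suc:
  assumes n: "1 \<le> n" and inf: "infinite (Psi \<nu> (Q n))"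
  shows "infinite (Psi \<nu> (Q (Suc n)))" "degree (Q (Suc (Suc n))) = degree (Q (Suc n))"
proof -
  let ?R = "Q (Suc n)"
  have R: "degree ?R > 0" "lead_coeff ?R = 1"
    using Q_facts[of "Suc n"] by auto
  have bound: "degree (Q (Suc (Suc n))) \<ge> degree ?R"
    using Phi_degree_ge[OF Q_Phi[of "Suc n"]] by simp
  have step: "tr ?R P < \<nu> P \<and> degree P = degree ?R \<and> lead_coeff P = 1"
    if P: "P \<in> Phi \<nu> (Q n)" "\<nu> P \<noteq> \<nu> ?R" for P
  proof -
    have deg: "degree P = degree ?R"
      using next_degree_Phi[OF P(1)] degree_Q_Suc[OF n] by simp
    have "\<nu> P \<in> Psi \<nu> (Q n)"
      using P(1) by (simp add: Psi_def)
    then have "\<nu> ?R \<le> \<nu> P"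
      unfolding val_Q_Suc[OF n] by (rule Inf_lower)
    then have less: "\<nu> ?R < \<nu> P"
      using P(2) by simp
    have "degree (P - ?R) < degree ?R"
      using degree_diff_monic_less[OF deg Phi_D(1)[OF P(1)] R(2,1)] .
    from truncation_affine[OF this] have "tr ?R P \<le> \<nu> ?R"
      by simp
    with less deg Phi_D(1)[OF P(1)] show ?thesis
      by auto
  qed
  have infd: "infinite (Psi \<nu> (Q n) - {\<nu> ?R})"
    using inf by simp
  then obtain P where P: "P \<in> Phi \<nu> (Q n)" "\<nu> P \<noteq> \<nu> ?R"
    unfolding Psi_def by (metis (no_types, lifting) DiffE finite.emptyI ex_in_conv imageE insertI1)
  have "next_degree \<nu> ?R \<le> degree ?R"
    unfolding next_degree_def using step[OF P] by (intro Least_le) blast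
  then show deg: "degree (Q (Suc (Suc n))) = degree ?R"
    using bound degree_Q_Suc[of "Suc n"] by simp
  have "Psi \<nu> (Q n) - {\<nu> ?R} \<subseteq> Psi \<nu> ?R"
  proof
    fix x assume "x \<in> Psi \<nu> (Q n) - {\<nu> ?R}"
    then obtain P where P: "P \<in> Phi \<nu> (Q n)" "x = \<nu> P" "\<nu> P \<noteq> \<nu> ?R"
      by (auto simp: Psi_def)
    have "P \<in> Phi \<nu> ?R"
      using step[OF P(1,3)] deg degree_Q_Suc[of "Suc n"] by (auto simp: Phi_def)
    then show "x \<in> Psi \<nu> ?R"
      by (simp add: Psi_def P(2))
  qed
  with infd show "infinite (Psi \<nu> ?R)"
    using finite_subset by blast
qed

end

section \<open>The limit when some Psi is infinite\<close>

locale limit_run = nonstopping_run +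
  assumes Psi_infinite: "\<exists>i\<ge>1. infinite (Psi \<nu> (Q i))"
begin

lemma eventually_constant_degree:
  obtains i d where "1 \<le> i" "0 < d" "\<And>n. i < n \<Longrightarrow> degree (Q n) = d"
proof -
  obtain i where i: "1 \<le> i" "infinite (Psi \<nu> (Q i))"
    using Psi_infinite by blast
  have "infinite (Psi \<nu> (Q n)) \<and> degree (Q (Suc n)) = degree (Q (Suc i))" if "i \<le> n" for n
    using that
  proof (induction n rule: dec_induct)
    case (step n)
    with i Psi_infinite_Suc[of n] show ?case by simp
  qed (use i in simp)
  from this[of "n - 1" for n] have "degree (Q n) = degree (Q (Suc i))" if "i < n" for n
    using that by (metis Suc_pred' gr_implies_not0 less_Suc_eq_le not_gr_zero)
  moreover have "0 < degree (Q (Suc i))"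
    using Q_facts(1)[of "Suc i"] by simp
  ultimately show ?thesis
    using that[OF i(1)] by blast
qed

text \<open>From some index on \<open>Q\<^sub>n\<close> has constant degree and \<open>\<nu> (Q\<^sub>n) = \<nu> (Q\<^sub>n\<^sub>+\<^sub>1 - Q\<^sub>n)\<close> is the value of
  a polynomial of smaller degree; such values lie in finitely many translates of \<open>\<int>\<close>.\<close>

lemma val_Q_unbounded:
  obtains d where "0 < d" "\<And>C. \<exists>n\<ge>1. degree (Q n) = d \<and> ereal C < \<nu> (Q n)"
proof -
  obtain i d where i: "1 \<le> i" "0 < d" "\<And>n. i < n \<Longrightarrow> degree (Q n) = d"
    using eventually_constant_degree by blast
  have same: "degree (Q (Suc n) - Q n) < d" "\<nu> (Q (Suc n) - Q n) = \<nu> (Q n)"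
      "\<nu> (Q n) < \<nu> (Q (Suc n))" if "i < n" for n
  proof -
    have n: "1 \<le> n" "degree (Q n) = d" "degree (Q (Suc n)) = d"
      using i that by auto
    then show "degree (Q (Suc n) - Q n) < d" "\<nu> (Q (Suc n) - Q n) = \<nu> (Q n)"
        "\<nu> (Q n) < \<nu> (Q (Suc n))"
      using Phi_same_degree[OF Q_facts(1)[OF n(1)] Q_facts(2)[OF n(1)] Q_Phi[OF n(1)]] by auto
  qed
  define x where "x k = real_of_ereal (\<nu> (Q (Suc i + k)))" for k
  have x: "\<nu> (Q (Suc i + k)) = ereal (x k)" for k
    using Q_facts(4)[of "Suc i + k"] val_not_MInf[of "Q (Suc i + k)"]
    by (cases "\<nu> (Q (Suc i + k))") (auto simp: x_def)
  have "strict_mono x"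
  proof (rule strict_mono_Suc_iff[THEN iffD2], rule allI)
    show "x k < x (Suc k)" for k
      using same(3)[of "Suc i + k"] x[of k] x[of "Suc k"] by simp
  qed
  moreover obtain F where F: "finite F" "\<forall>f. f \<noteq> 0 \<longrightarrow> degree f \<le> d \<longrightarrow>
      (\<exists>c\<in>F. \<exists>z::int. tr (Q i) f = ereal (of_int z + c))"
    using truncation_discrete[OF i(1), of d] by blast
  moreover have "\<exists>c\<in>F. \<exists>z::int. x k = of_int z + c" for k
  proof -
    define r where "r = Q (Suc (Suc i + k)) - Q (Suc i + k)"
    have r: "degree r < d" "\<nu> r = ereal (x k)"
      using same[of "Suc i + k"] x[of k] by (auto simp: r_def)
    then have "r \<noteq> 0" by auto
    \<comment> \<open>The degree of r is below that of \<open>Q (Suc i)\<close>, so the fixed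
      truncation at i computes all these values, and one finite set \<open>F\<close> serves every
      k.\<close>
    have "tr (Q i) r = ereal (x k)"
      using truncation_below[OF i(1), of r] r i(3)[of "Suc i"] by simp
    moreover have "\<exists>c\<in>F. \<exists>z::int. tr (Q i) r = ereal (of_int z + c)"
      using F(2) \<open>r \<noteq> 0\<close> r(1) by (meson less_imp_le)
    ultimately show ?thesis by simp
  qed
  ultimately have unb: "\<exists>k. x k > C" for C
    using strict_mono_unbounded by blast
  have "\<exists>n\<ge>1. degree (Q n) = d \<and> ereal C < \<nu> (Q n)" for C
  proof -
    obtain k where "C < x k"
      using unb by blast
    then show ?thesis
      using x[of k] i(3)[of "Suc i + k"] by (intro exI[of _ "Suc i + k"]) simp
  qed
  with i(2) that show ?thesis by blast
qed

text \<open>The derivative of order d of a monic polynomial of degree d is 1, so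
  \<open>epsilon\<close> is at least the value divided by the fixed d.\<close>

lemma epsilon_Q_unbounded: "\<exists>n\<ge>1. ereal C < epsilon \<nu> (Q n)"
proof -
  obtain d where d: "0 < d" "\<And>C. \<exists>n\<ge>1. degree (Q n) = d \<and> ereal C < \<nu> (Q n)"
    by (rule val_Q_unbounded) blast
  obtain n where n: "1 \<le> n" "degree (Q n) = d" "ereal (real d * C) < \<nu> (Q n)"
    using d(2) by blast
  have "\<nu> (hasse_deriv d (Q n)) = 0"
    using hasse_deriv_degree[of "Q n"] n Q_facts(2)[OF n(1)] by (simp flip: one_pCons)
  then have "\<nu> (hasse_deriv d (Q n)) = ereal (real d * C - real d * C)"
    by (simp add: zero_ereal_def)
  from epsilon_gtI[OF _ this n(3)] d(1) n(1) show ?thesis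
    by auto
qed

text \<open>If all truncations were strict, \<open>truncation_hasse\<close> would give a derivative
  of value v - b e with v below the finite value of f. Since e is unbounded, this falls below every
  finite value of a derivative of f.\<close>

lemma val_eq_truncation:
  assumes "\<nu> f \<noteq> \<infinity>"
  shows "\<exists>n\<ge>1. tr (Q n) f = \<nu> f"
proof (rule ccontr)
  assume neg: "\<not> ?thesis"
  obtain w where w: "\<nu> f = ereal w"
    using assms by (rule val_finiteE)
  have "f \<noteq> 0"
    using assms by auto
  define V where "V = insert 0 ((\<lambda>b. real_of_ereal (\<nu> (hasse_deriv b f))) ` {..degree f})"
  define C where "C = Min V"
  have C: "C \<le> u" if "b \<le> degree f" "\<nu> (hasse_deriv b f) = ereal u" for b u
    unfolding C_def using that
    by (intro Min_le) (auto simp: V_def intro!: image_eqI[of _ _ b])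
  \<comment> \<open>Besides e > w - C, positivity of e is required, so that b e \<ge> e for b \<ge>
    1.\<close>
  obtain n where n: "1 \<le> n" "ereal (max 0 (w - C)) < epsilon \<nu> (Q n)"
    using epsilon_Q_unbounded by blast
  note key = finite_key_Q[OF n(1)]
  obtain e where e: "epsilon \<nu> (Q n) = ereal e"
    using key_contact[OF key] by blast
  have "tr (Q n) f < \<nu> f"
    using neg truncation_le_val[OF Q_facts(1)[OF n(1)], of f] n(1) by (auto simp: less_le)
  moreover obtain v where v: "tr (Q n) f = ereal v"
    using truncation_finite[OF key \<open>f \<noteq> 0\<close>] truncation_not_MInf[OF Q_facts(1)[OF n(1)], of f]
    by (cases "tr (Q n) f") auto
  ultimately obtain b where b: "1 \<le> b" "b \<le> degree f"
      "\<nu> (hasse_deriv b f) = ereal (v - real b * e)"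
    using truncation_hasse[OF key e] by metis
  have "v < w"
    using \<open>tr (Q n) f < \<nu> f\<close> v w by simp
  have "0 < e" "w - C < e"
    using n(2) e by auto
  moreover have "e \<le> real b * e"
    using b(1) \<open>0 < e\<close> mult_right_mono[of 1 "real b" e] by simp
  ultimately show False
    using C[OF b(2,3)] \<open>v < w\<close> by linarith
qed

lemma complete_trivial_support:
  assumes "\<nu> -` {\<infinity>} = {0}"
  shows "complete_for \<nu> {1..} Q"
proof (rule complete_forI)
  show "key_polynomial \<nu> (Q i)" if "i \<in> {1..}" for i
    using that Q_facts(3) by simp
  fix \<beta> f
  assume \<beta>: "\<beta> \<le> \<nu> f"
  show "f \<in> group_closure (monomials {1..} Q \<beta>)"
  proof (cases "\<nu> f = \<infinity>")
    case True
    then have "f = 0" using assms by blast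
    then show ?thesis by simp
  next
    case False
    then obtain n where n: "1 \<le> n" "tr (Q n) f = \<nu> f"
      using val_eq_truncation by blast
    have "f \<in> group_closure (monomials {1..n} Q \<beta>)"
      using generated_by_initial_segment[OF n(1)] n(2) \<beta> by simp
    then show ?thesis
      by (rule group_closure_monomials_mono) auto
  qed
qed

lemma monomials_append_omega:
  "monomials {1..n} Q \<beta> \<subseteq> monomials {1..<\<infinity>} (append_omega Q R) \<beta>"
proof
  fix f
  assume "f \<in> monomials {1..n} Q \<beta>"
  then obtain a S \<gamma> where f: "f = [:a:] * (\<Prod>i\<in>S. Q i ^ \<gamma> i)" "finite S" "S \<subseteq> {1..n}"
    "\<beta> \<le> \<nu> [:a:] + (\<Sum>i\<in>S. ereal (real (\<gamma> i)) * \<nu> (Q i))"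
    by (rule monomialsE)
  have inj: "inj_on enat S"
    by (simp add: inj_on_def)
  have "[:a:] * (\<Prod>i\<in>enat ` S. append_omega Q R i ^ (\<gamma> \<circ> the_enat) i)
      \<in> monomials {1..<\<infinity>} (append_omega Q R) \<beta>"
    using f by (intro monomialsI) (auto simp: sum.reindex[OF inj] append_omega_def one_enat_def)
  then show "f \<in> monomials {1..<\<infinity>} (append_omega Q R) \<beta>"
    by (simp add: f(1) prod.reindex[OF inj] append_omega_def)
qed

text \<open>The generator is a monic nonzero polynomial of least degree among those of infinite
  value; division with remainder shows that it divides all others.\<close>

lemma nontrivial_support:
  assumes "\<nu> -` {\<infinity>} \<noteq> {0}"
  obtains R where "key_polynomial \<nu> R" "\<nu> -` {\<infinity>} = {f. R dvd f}"
    "is_arg_min degree (\<lambda>f. \<forall>i\<ge>1. tr (Q i) f < \<nu> f) R"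
    "complete_for \<nu> {1..} (append_omega Q R)"
proof -
  have "0 \<in> \<nu> -` {\<infinity>}" by simp
  with assms have "\<exists>f. f \<noteq> 0 \<and> \<nu> f = \<infinity>"
    by blast
  then obtain g where g: "g \<noteq> 0" "\<nu> g = \<infinity>"
      and g_min: "\<And>f. f \<noteq> 0 \<Longrightarrow> \<nu> f = \<infinity> \<Longrightarrow> degree g \<le> degree f"
    using ex_has_least_nat[of "\<lambda>f. f \<noteq> 0 \<and> \<nu> f = \<infinity>" _ degree] by blast
  define R where "R = smult (inverse (lead_coeff g)) g"
  have R: "R \<noteq> 0" "lead_coeff R = 1" "degree R = degree g"
    using g by (auto simp: R_def)
  have vR: "\<nu> R = \<infinity>"
    using val_mult[of "[:inverse (lead_coeff g):]" g] g by (simp add: R_def)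
  have R_min: "degree R \<le> degree f" if "f \<noteq> 0" "\<nu> f = \<infinity>" for f
    using g_min[OF that] R by simp
  have support: "\<nu> -` {\<infinity>} = {f. R dvd f}"
  proof (intro set_eqI iffI)
    fix f assume "f \<in> \<nu> -` {\<infinity>}"
    then have "\<nu> f = \<infinity>" by simp
    moreover have "\<nu> (f div R * R) = \<infinity>"
      by (simp add: val_mult vR)
    ultimately have "\<nu> (f - f div R * R) = \<infinity>"
      using val_diff[of f "f div R * R"] by simp
    then have "\<nu> (f mod R) = \<infinity>"
      by (simp add: minus_div_mult_eq_mod)
    then have "f mod R = 0"
      using R_min[of "f mod R"] degree_mod_less[OF R(1), of f] by fastforce
    then show "f \<in> {f. R dvd f}" by auto
  next
    fix f assume "f \<in> {f. R dvd f}"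
    then show "f \<in> \<nu> -` {\<infinity>}"
      by (auto simp: val_mult vR)
  qed
  \<comment> \<open>\<open>epsilon\<close> of R is \<infinity>, and only polynomials of infinite
    value reach that.\<close>
  have key: "key_polynomial \<nu> R"
    unfolding key_polynomial_def
  proof (intro conjI allI impI)
    fix f :: "'a Ky"
    assume f: "f \<noteq> 0" "epsilon \<nu> R \<le> epsilon \<nu> f"
    then have eps: "epsilon \<nu> f = \<infinity>"
      using epsilon_infinite[OF vR R(1)] by simp
    then have "\<nu> f = \<infinity>"
      using epsilon_finite by blast
    with R_min[OF f(1)] show "degree R \<le> degree f" .
  qed (use R vR in auto)
  have arg_min: "is_arg_min degree (\<lambda>f. \<forall>i\<ge>1. tr (Q i) f < \<nu> f) R"
    unfolding is_arg_min_def
  proof (intro conjI allI impI notI)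
    show "tr (Q i) R < \<nu> R" if "1 \<le> i" for i
      using truncation_finite[OF finite_key_Q[OF that] R(1)] vR by simp
    assume "\<exists>f. (\<forall>i\<ge>1. tr (Q i) f < \<nu> f) \<and> degree f < degree R"
    then obtain f where f: "\<And>i. 1 \<le> i \<Longrightarrow> tr (Q i) f < \<nu> f" "degree f < degree R"
      by blast
    \<comment> \<open>A polynomial of finite value equals some truncation in value. The zero
      polynomial is no competitor, since its truncations are infinite too.\<close>
    have "\<nu> f = \<infinity>"
      using val_eq_truncation[of f] f(1) by force
    moreover have "f \<noteq> 0"
      using f(1)[of 1] truncation_low_degree[of 0 "Q 1"] Q_facts(1)[of 1] by auto
    ultimately show False
      using R_min[of f] f(2) by simp
  qed
  have "complete_for \<nu> {1..} (append_omega Q R)"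
  proof (rule complete_forI)
    show "key_polynomial \<nu> (append_omega Q R i)" if "i \<in> {1..}" for i
      using that Q_facts(3) key by (cases i) (auto simp: append_omega_def one_enat_def)
    fix \<beta> f
    assume \<beta>: "\<beta> \<le> \<nu> f"
    have fin: "h \<in> group_closure (monomials {1..<\<infinity>} (append_omega Q R) \<alpha>)"
      if "1 \<le> n" "\<alpha> \<le> tr (Q n) h" for n h \<alpha>
      using generated_by_initial_segment[OF that] group_closure_mono[OF monomials_append_omega]
      by blast
    show "f \<in> group_closure (monomials {1..} (append_omega Q R) \<beta>)"
    proof (cases "\<nu> f = \<infinity>")
      case True
      then have "R dvd f"
        using support by auto
      then obtain h where h: "f = h * R"
        by (metis dvdE mult.commute)
      \<comment> \<open>h is generated without the index \<infinity>, which is therefore free for R;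
        adding the infinite value of R raises whatever bound h satisfies to \<infinity>, above every
        \<beta>.\<close>
      have "h \<in> group_closure (monomials {1..<\<infinity>} (append_omega Q R) (tr (Q 1) h))"
        by (intro fin[of 1]) auto
      from group_closure_monomials_mult[OF this, of \<infinity> 1]
      have "h * R \<in> group_closure (monomials (insert \<infinity> {1..<\<infinity>}) (append_omega Q R)
          (tr (Q 1) h + \<infinity>))"
        by (simp add: append_omega_def vR)
      then show ?thesis
        unfolding h by (rule group_closure_monomials_mono) auto
    next
      case False
      then obtain n where n: "1 \<le> n" "tr (Q n) f = \<nu> f"
        using val_eq_truncation by blast
      have "f \<in> group_closure (monomials {1..<\<infinity>} (append_omega Q R) \<beta>)"
        using fin[OF n(1)] n(2) \<beta> by simp
      then show ?thesis
        by (rule group_closure_monomials_mono) auto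
    qed
  qed
  with key support arg_min show ?thesis
    by (rule that)
qed

end

theorem theorem4p22:
  fixes \<nu> :: "'k::field Ky \<Rightarrow> ereal" and Q :: "nat \<Rightarrow> 'k Ky"
  assumes "\<nu> \<in> Vx"
    and "infinite_run \<nu> Q"
    and "\<exists>i\<ge>1. infinite (Psi \<nu> (Q i))"
  shows "(\<nu> -` {\<infinity>} = {0} \<longrightarrow> complete_for \<nu> {1..} Q) \<and>
    (\<nu> -` {\<infinity>} \<noteq> {0} \<longrightarrow>
      (\<exists>Q\<omega>. key_polynomial \<nu> Q\<omega> \<and>
        \<nu> -` {\<infinity>} = {f. Q\<omega> dvd f} \<and>
        is_arg_min degree (\<lambda>f. \<forall>i\<ge>1. truncation \<nu> (Q i) f < \<nu> f) Q\<omega> \<and>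
        complete_for \<nu> {1..} (append_omega Q Q\<omega>)))"
proof -
  interpret limit_run \<nu> Q
    using assms by unfold_locales
  show ?thesis
  proof (intro conjI impI)
    show "complete_for \<nu> {1..} Q" if "\<nu> -` {\<infinity>} = {0}"
      using that by (rule complete_trivial_support)
    assume "\<nu> -` {\<infinity>} \<noteq> {0}"
    then obtain R where "key_polynomial \<nu> R" "\<nu> -` {\<infinity>} = {f. R dvd f}"
        "is_arg_min degree (\<lambda>f. \<forall>i\<ge>1. truncation \<nu> (Q i) f < \<nu> f) R"
        "complete_for \<nu> {1..} (append_omega Q R)"
      by (rule nontrivial_support)
    then show "\<exists>Q\<omega>. key_polynomial \<nu> Q\<omega> \<and>
        \<nu> -` {\<infinity>} = {f. Q\<omega> dvd f} \<and>
        is_arg_min degree (\<lambda>f. \<forall>i\<ge>1. truncation \<nu> (Q i) f < \<nu> f) Q\<omega> \<and>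
        complete_for \<nu> {1..} (append_omega Q Q\<omega>)"
      by (intro exI conjI)
  qed
qed

end
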